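(* There exist universal constants $C_1, C_2>0$ such that the following holds. Let $m \ge n \ge 1$, $r\ge 1$, $\alpha>0$, let $f:\mathbb{R}\to[0,1]$ be twice differentiable with $f(x)$ log-concave in $x$, and let $\gamma_\alpha$ and $L_\alpha$ be as in the context, with $\gamma_\alpha>0$. Suppose that $M^*\in\mathcal{C}$, that the bipartite graph $G$ associated with $\Omega\subseteq[m]\times[n]$ satisfies assumptions (A1) and (A2) (with constant $C>0$ in (A2)), and that $Y$ is generated from $M^*$ according to the 1-bit observation model. Then with probability at least $1-C_1\exp(-C_2 m)$, any global minimizer $\widehat{M}$ of $$\min_{M} F_{\Omega,Y}(M)\quad\text{subject to}\quad \|M\|_\infty\le\alpha,\ \operatorname{rank}(M)\le r$$ satisfies $$\frac{1}{\sqrt{mn}}\|\widehat{M}-M^*\|_F \le \max\left(\frac{C_{1\alpha}\, r\,\sigma_2(G)}{\sigma_1(G)},\ \frac{C_{2\alpha}\, m\sqrt{r^3 n}}{\sigma_1^2(G)}\right) \le \max\left(\frac{C_{1\alpha}\, C\, r\sqrt{m}}{\sqrt{|\Omega|}},\ \frac{C_{2\alpha}\, m^3\sqrt{r^3 n}}{|\Omega|^2}\right),$$ where $C_{1\alpha}=4\sqrt{2}\,\alpha$ and $C_{2\alpha}=32.16\sqrt{2}\,L_\alpha/\gamma_\alpha$.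
   Context: Norms: for a real matrix $A$, $\|A\|_\infty=\max_{i,j}|A_{ij}|$ (entrywise) and $\|A\|_F$ is the Frobenius norm. $[n]=\{1,\dots,n\}$. Constraint set: $\mathcal{C}=\{M\in\mathbb{R}^{m\times n}: \|M\|_\infty\le\alpha,\ \operatorname{rank}(M)\le r\}$. 1-bit observation model: for a fixed matrix $M^*\in\mathbb{R}^{m\times n}$ and a fixed index set $\Omega\subseteq[m]\times[n]$, the random variables $Y_{ij}$, $(i,j)\in\Omega$, are independent, with $Y_{ij}=+1$ with probability $f(M^*_{ij})$ and $Y_{ij}=-1$ with probability $1-f(M^*_{ij})$. Negative log-likelihood ($\mathbb{I}$ denotes the indicator): $$F_{\Omega,Y}(M)=-\sum_{(i,j)\in\Omega}\Big\{\mathbb{I}_{(Y_{ij}=1)}\log f(M_{ij})+\mathbb{I}_{(Y_{ij}=-1)}\log(1-f(M_{ij}))\Big\}.$$ With $\dot f,\ddot f$ the first and second derivatives of $f$, $\gamma_\alpha$ and $L_\alpha$ are real numbers satisfying $$\gamma_\alpha\le\min\left(\inf_{|x|\le\alpha}\Big\{\frac{\dot f^2(x)}{f^2(x)}-\frac{\ddot f(x)}{f(x)}\Big\},\ \inf_{|x|\le\alpha}\Big\{\frac{\dot f^2(x)}{(1-f(x))^2}+\frac{\ddot f(x)}{1-f(x)}\Big\}\right),\qquad L_\alpha\ge\sup_{|x|\le\alpha}\frac{|\dot f(x)|}{f(x)(1-f(x))}$$ (it is implicit that $0<f(x)<1$ for $|x|\le\alpha$, so that these are well defined). Graph: $G$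 is the bipartite graph on $([m],[n])$ with edge set $\Omega$, identified with its $m\times n$ bi-adjacency matrix: $G_{ij}=1$ if $(i,j)\in\Omega$ and $G_{ij}=0$ otherwise. $\sigma_1(G)\ge\sigma_2(G)$ are its largest and second largest singular values. It is assumed that each row of $G$ has exactly $d$ nonzero entries, so $|\Omega|=md$. (A1) The top left and right singular vectors of $G$ are $\mathbf{1}_m/\sqrt m$ and $\mathbf{1}_n/\sqrt n$ ($\mathbf{1}_k$ is the all-ones vector in $\mathbb{R}^k$). This implies $\sigma_1(G)=d\sqrt{m/n}\ge d$ and that each column of $G$ has $md/n$ nonzero entries. (A2) $\sigma_2(G)\le C\sqrt d$, where $C>0$ is a universal constant. *)

theory Defs
  imports
    "HOL-Analysis.Analysis"
    "HOL-Probability.Product_PMF"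
    "HOL-Computational_Algebra.Polynomial"
    "Jordan_Normal_Form.Char_Poly"
    "Jordan_Normal_Form.DL_Rank"
begin

text \<open>
  The dimensions \<open>m\<close>, \<open>n\<close> are quantified after the universal constants, so matrices are those of
  Jordan_Normal_Form, with explicit carriers.  Indices start at 0: the index set of an
  \<open>m \<times> n\<close> matrix is \<open>{..<m} \<times> {..<n}\<close>.
\<close>

definition entry_norm :: "real mat \<Rightarrow> real" where
  "entry_norm A = Max (abs ` elements_mat A)"

definition frobenius_norm :: "real mat \<Rightarrow> real" where
  "frobenius_norm A = sqrt (\<Sum>i<dim_row A. \<Sum>j<dim_col A. (A $$ (i, j))\<^sup>2)"

text \<open>
  Singular values, in decreasing order and with multiplicity: the square roots of the eigenvalues
  of the symmetric positive semidefinite matrix \<open>A\<^sup>T A\<close>, which has \<open>dim_col A\<close> real eigenvalues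
  counted with algebraic multiplicity.  \<open>singular_value A k\<close> is the \<open>k\<close>-th largest, counting
  from \<open>k = 1\<close>; beyond the end of the list it is 0 (so the second singular value of a matrix
  with one column is 0).
\<close>

definition singular_values :: "real mat \<Rightarrow> real list" where
  "singular_values A =
     rev (sorted_list_of_multiset (image_mset sqrt (proots (char_poly (A\<^sup>T * A)))))"

definition singular_value :: "real mat \<Rightarrow> nat \<Rightarrow> real" where
  "singular_value A k =
     (if 1 \<le> k \<and> k \<le> length (singular_values A) then singular_values A ! (k - 1) else 0)"

definition singular_vectors :: "real mat \<Rightarrow> real \<Rightarrow> real Matrix.vec \<Rightarrow> real Matrix.vec \<Rightarrow> bool" where
  "singular_vectors A s u v \<longleftrightarrow>
     u \<in> carrier_vec (dim_row A) \<and> v \<in> carrier_vec (dim_col A) \<and>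
     scalar_prod u u = 1 \<and> scalar_prod v v = 1 \<and>
     A *\<^sub>v v = s \<cdot>\<^sub>v u \<and> A\<^sup>T *\<^sub>v u = s \<cdot>\<^sub>v v"

definition ones_vec :: "nat \<Rightarrow> real Matrix.vec" where
  "ones_vec k = Matrix.vec k (\<lambda>_. 1)"

definition constraint_set :: "nat \<Rightarrow> nat \<Rightarrow> real \<Rightarrow> nat \<Rightarrow> real mat set" where
  "constraint_set m n \<alpha> r =
     {M \<in> carrier_mat m n. entry_norm M \<le> \<alpha> \<and> vec_space.rank m M \<le> r}"

text \<open>
  The joint law of independent signs \<open>Y (i, j)\<close>, \<open>(i, j) \<in> \<Omega>\<close>.  Outside \<open>\<Omega>\<close> the sample is constantly
  0, a dummy value which the likelihood never inspects.
\<close>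

definition one_bit_observations ::
  "(real \<Rightarrow> real) \<Rightarrow> (nat \<times> nat) set \<Rightarrow> real mat \<Rightarrow> (nat \<times> nat \<Rightarrow> int) pmf" where
  "one_bit_observations f \<Omega> M =
     Pi_pmf \<Omega> 0 (\<lambda>ij. map_pmf (\<lambda>b. if b then 1 else - 1) (bernoulli_pmf (f (M $$ ij))))"

definition neg_log_likelihood ::
  "(real \<Rightarrow> real) \<Rightarrow> (nat \<times> nat) set \<Rightarrow> (nat \<times> nat \<Rightarrow> int) \<Rightarrow> real mat \<Rightarrow> real" where
  "neg_log_likelihood f \<Omega> Y M =
     - (\<Sum>ij\<in>\<Omega>. of_bool (Y ij = 1) * ln (f (M $$ ij)) +
                 of_bool (Y ij = - 1) * ln (1 - f (M $$ ij)))"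

text \<open>
  Log-concavity of a nonnegative function, in the multiplicative form that allows zeros of \<open>f\<close>
  (where \<open>ln (f x)\<close> would not be \<open>-\<infinity>\<close> but 0).
\<close>

definition log_concave_fun :: "(real \<Rightarrow> real) \<Rightarrow> bool" where
  "log_concave_fun f \<longleftrightarrow>
     (\<forall>x y t. 0 < t \<and> t < 1 \<longrightarrow>
        f x powr t * f y powr (1 - t) \<le> f (t * x + (1 - t) * y))"

text \<open>
  The infima and the supremum are taken in the extended reals, since they are not assumed finite.
\<close>

definition gamma_bound :: "(real \<Rightarrow> real) \<Rightarrow> real \<Rightarrow> real \<Rightarrow> bool" where
  "gamma_bound f \<alpha> \<gamma> \<longleftrightarrow>
     ereal \<gamma> \<le>
       min (INF x\<in>{x. \<bar>x\<bar> \<le> \<alpha>}. ereal ((deriv f x)\<^sup>2 / (f x)\<^sup>2 - deriv (deriv f) x / f x))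
           (INF x\<in>{x. \<bar>x\<bar> \<le> \<alpha>}.
              ereal ((deriv f x)\<^sup>2 / (1 - f x)\<^sup>2 + deriv (deriv f) x / (1 - f x)))"

definition L_bound :: "(real \<Rightarrow> real) \<Rightarrow> real \<Rightarrow> real \<Rightarrow> bool" where
  "L_bound f \<alpha> L \<longleftrightarrow>
     (SUP x\<in>{x. \<bar>x\<bar> \<le> \<alpha>}. ereal (\<bar>deriv f x\<bar> / (f x * (1 - f x)))) \<le> ereal L"

definition biadjacency :: "nat \<Rightarrow> nat \<Rightarrow> (nat \<times> nat) set \<Rightarrow> real mat" where
  "biadjacency m n \<Omega> = Matrix.mat m n (\<lambda>ij. if ij \<in> \<Omega> then 1 else 0)"

definition row_regular :: "nat \<Rightarrow> nat \<Rightarrow> (nat \<times> nat) set \<Rightarrow> nat \<Rightarrow> bool" where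
  "row_regular m n \<Omega> d \<longleftrightarrow> (\<forall>i<m. card {j. j < n \<and> (i, j) \<in> \<Omega>} = d)"

definition assumption_A1 :: "real mat \<Rightarrow> bool" where
  "assumption_A1 G \<longleftrightarrow>
     singular_vectors G (singular_value G 1)
       ((1 / sqrt (real (dim_row G))) \<cdot>\<^sub>v ones_vec (dim_row G))
       ((1 / sqrt (real (dim_col G))) \<cdot>\<^sub>v ones_vec (dim_col G))"

definition assumption_A2 :: "real mat \<Rightarrow> nat \<Rightarrow> real \<Rightarrow> bool" where
  "assumption_A2 G d C \<longleftrightarrow> singular_value G 2 \<le> C * sqrt (real d)"

end

theory Submission
  imports Defs "HOL-Probability.Hoeffding"
begin

text \<open>
  Let \<open>D = Mhat - Mstar\<close>.  Strong convexity of the likelihood on the box of radius \<open>\<alpha>\<close>, together with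
  the optimality of \<open>Mhat\<close>, bounds \<open>\<gamma>/2\<close> times the squared Frobenius norm of \<open>D\<close> on \<open>\<Omega>\<close> by
  \<open>- \<langle>Z, D\<rangle>\<close>, where the score matrix \<open>Z\<close> has independent centred entries in intervals of length \<open>L\<close>.
  Hoeffding's inequality and a grid of the two unit balls give \<open>\<parallel>Z\<parallel> \<le> 4.7 L sqrt m\<close> outside an event of
  probability \<open>exp (- m)\<close>, so that \<open>- \<langle>Z, D\<rangle> \<le> 4.7 L sqrt m sqrt (2 r) \<parallel>D\<parallel>\<^sub>F\<close>.  Conversely the spectral
  gap of \<open>G\<close>, applied to the entrywise square of \<open>D\<close> (of rank at most \<open>(2 r)\<^sup>2\<close>), shows that the
  squared norm of \<open>D\<close> on \<open>\<Omega>\<close> is at least \<open>\<sigma>\<^sub>1 / sqrt (m n) \<parallel>D\<parallel>\<^sub>F\<^sup>2 - 4 r \<alpha> \<sigma>\<^sub>2 \<parallel>D\<parallel>\<^sub>F\<close>.  The two estimates combine to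
  \<open>\<parallel>D\<parallel>\<^sub>F / sqrt (m n) \<le> a + b\<close> with \<open>a = 4 r \<alpha> \<sigma>\<^sub>2 / \<sigma>\<^sub>1\<close>, and
  \<open>a + b \<le> max (sqrt 2 a) ((2 + sqrt 2) b)\<close>.
\<close>

unbundle no vec_syntax

section \<open>Bilinear forms and low-rank matrices\<close>

text \<open>For \<open>0 \<le> s\<close> this is the operator norm bound
  \<open>\<parallel>A\<parallel> \<le> s\<close>. The homogeneous form over functions on index sets
  avoids both carriers and normalised vectors.\<close>

definition bilinear_bound :: "'a set \<Rightarrow> 'b set \<Rightarrow> ('a \<Rightarrow> 'b \<Rightarrow> real) \<Rightarrow> real \<Rightarrow> bool" where
  "bilinear_bound I J A s \<longleftrightarrow>
     (\<forall>x y. (\<Sum>i\<in>I. \<Sum>j\<in>J. x i * A i j * y j) \<le> s * L2_set x I * L2_set y J)"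

lemma L2_set_mult_ineq':
  "(\<Sum>i\<in>I. f i * g i) \<le> L2_set f I * L2_set g I"
proof -
  have "(\<Sum>i\<in>I. f i * g i) \<le> (\<Sum>i\<in>I. \<bar>f i\<bar> * \<bar>g i\<bar>)"
    by (intro sum_mono) (simp flip: abs_mult)
  then show ?thesis
    using L2_set_mult_ineq[where f=f and g=g and A=I] by linarith
qed

text \<open>Gram-Schmidt without normalisation, applied to the left factors; some \<open>e l\<close>
  may be zero, which covers linearly dependent \<open>a l\<close>.\<close>

lemma orthogonal_decomposition:
  fixes a :: "nat \<Rightarrow> 'a \<Rightarrow> real" and b :: "nat \<Rightarrow> 'b \<Rightarrow> real"
  assumes "finite I"
  shows "\<exists>e w. (\<forall>k<p. \<forall>l<p. k \<noteq> l \<longrightarrow> (\<Sum>i\<in>I. e k i * e l i) = 0) \<and>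
           (\<forall>i\<in>I. \<forall>j. (\<Sum>l<p. a l i * b l j) = (\<Sum>l<p. e l i * w l j))"
proof (induction p)
  case 0
  show ?case by simp
next
  case (Suc p)
  then obtain e :: "nat \<Rightarrow> 'a \<Rightarrow> real" and w :: "nat \<Rightarrow> 'b \<Rightarrow> real"
    where ew: "(\<forall>k<p. \<forall>l<p. k \<noteq> l \<longrightarrow> (\<Sum>i\<in>I. e k i * e l i) = 0) \<and>
           (\<forall>i\<in>I. \<forall>j. (\<Sum>l<p. a l i * b l j) = (\<Sum>l<p. e l i * w l j))"
    by (elim exE)
  have orth: "(\<Sum>i\<in>I. e k i * e l i) = 0" if "k < p" "l < p" "k \<noteq> l" for k l
    using ew that by simp
  have dec: "(\<Sum>l<p. a l i * b l j) = (\<Sum>l<p. e l i * w l j)" if "i \<in> I" for i j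
    using ew that by simp
  define c where "c l = (\<Sum>i\<in>I. a p i * e l i) / (\<Sum>i\<in>I. e l i * e l i)" for l
  \<comment> \<open>If \<open>e l\<close> vanishes on \<open>I\<close>, the quotient defining
    \<open>c l\<close> is 0 by the convention on division, and both sides are 0.\<close>
  have c: "c l * (\<Sum>i\<in>I. e l i * e l i) = (\<Sum>i\<in>I. a p i * e l i)" for l
  proof (cases "(\<Sum>i\<in>I. e l i * e l i) = 0")
    case True
    then have "\<forall>i\<in>I. e l i = 0"
      using assms by (subst (asm) sum_nonneg_eq_0_iff) auto
    then show ?thesis by simp
  qed (simp add: c_def)
  define e' where "e' = e(p := (\<lambda>i. a p i - (\<Sum>l<p. c l * e l i)))"
  \<comment> \<open>Substituting \<open>a p = e' p + (\<Sum>l<p. c l * e l)\<close> into the new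
    rank-one term moves \<open>c l * b p\<close> into the \<open>l\<close>-th right factor.\<close>
  define w' where "w' = (\<lambda>l j. if l = p then b p j else w l j + c l * b p j)"
  have e'_old: "e' l = e l" if "l < p" for l
    using that by (simp add: e'_def)
  have new: "(\<Sum>i\<in>I. e' p i * e k i) = 0" if k: "k < p" for k
  proof -
    have "(\<Sum>i\<in>I. e' p i * e k i) = (\<Sum>i\<in>I. a p i * e k i) - (\<Sum>i\<in>I. \<Sum>l<p. c l * (e l i * e k i))"
      by (simp add: e'_def algebra_simps sum_subtractf sum_distrib_left)
    also have "(\<Sum>i\<in>I. \<Sum>l<p. c l * (e l i * e k i)) = (\<Sum>l<p. c l * (\<Sum>i\<in>I. e l i * e k i))"
      by (subst sum.swap) (simp add: sum_distrib_left)
    also have "\<dots> = (\<Sum>l<p. if l = k then c k * (\<Sum>i\<in>I. e k i * e k i) else 0)"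
      by (intro sum.cong) (use orth k in auto)
    also have "\<dots> = (\<Sum>i\<in>I. a p i * e k i)"
      using k c by simp
    finally show ?thesis by simp
  qed
  have "(\<Sum>i\<in>I. e' k i * e' l i) = 0" if "k < Suc p" "l < Suc p" "k \<noteq> l" for k l
    using that new orth e'_old
    by (cases "k = p"; cases "l = p") (auto simp: less_Suc_eq mult.commute)
  moreover have "(\<Sum>l<Suc p. a l i * b l j) = (\<Sum>l<Suc p. e' l i * w' l j)" if "i \<in> I" for i j
  proof -
    have "(\<Sum>l<p. e' l i * w' l j) = (\<Sum>l<p. e l i * w l j) + (\<Sum>l<p. c l * e l i) * b p j"
      by (simp add: e'_old w'_def algebra_simps sum.distrib sum_distrib_left)
    then show ?thesis
      using dec[OF that] by (simp add: e'_def w'_def algebra_simps)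
  qed
  ultimately show ?case by blast
qed

lemma sum_rotate3:
  "(\<Sum>i\<in>I. \<Sum>j\<in>J. \<Sum>l\<in>K. f i j l) = (\<Sum>l\<in>K. \<Sum>i\<in>I. \<Sum>j\<in>J. f i j l)"
proof -
  have "(\<Sum>i\<in>I. \<Sum>j\<in>J. \<Sum>l\<in>K. f i j l) = (\<Sum>i\<in>I. \<Sum>l\<in>K. \<Sum>j\<in>J. f i j l)"
    by (intro sum.cong refl sum.swap)
  then show ?thesis
    using sum.swap[of "\<lambda>i l. \<Sum>j\<in>J. f i j l" K I] by simp
qed

text \<open>Pythagoras for the Frobenius norm: in the expanded square every cross term contains an
  inner product of two different \<open>e k\<close>, \<open>e l\<close>.\<close>

lemma orthogonal_sum_squares:
  fixes e :: "nat \<Rightarrow> 'a \<Rightarrow> real"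
  assumes orth: "\<And>k l. k < p \<Longrightarrow> l < p \<Longrightarrow> k \<noteq> l \<Longrightarrow> (\<Sum>i\<in>I. e k i * e l i) = 0"
  shows "(\<Sum>i\<in>I. \<Sum>j\<in>J. (\<Sum>l<p. e l i * w l j)\<^sup>2) = (\<Sum>l<p. (\<Sum>i\<in>I. (e l i)\<^sup>2) * (\<Sum>j\<in>J. (w l j)\<^sup>2))"
proof -
  have "(\<Sum>i\<in>I. \<Sum>j\<in>J. (\<Sum>l<p. e l i * w l j)\<^sup>2) =
      (\<Sum>i\<in>I. \<Sum>j\<in>J. \<Sum>k<p. \<Sum>l<p. (e k i * e l i) * (w k j * w l j))"
    unfolding power2_eq_square sum_product by (intro sum.cong refl) (simp add: mult_ac)
  also have "\<dots> = (\<Sum>k<p. \<Sum>l<p. \<Sum>i\<in>I. \<Sum>j\<in>J. (e k i * e l i) * (w k j * w l j))"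
    by (subst sum_rotate3) (intro sum.cong refl sum_rotate3)
  also have "\<dots> = (\<Sum>k<p. \<Sum>l<p. (\<Sum>i\<in>I. e k i * e l i) * (\<Sum>j\<in>J. w k j * w l j))"
    by (intro sum.cong refl) (simp add: sum_product)
  also have "\<dots> = (\<Sum>k<p. \<Sum>l<p. if l = k then (\<Sum>i\<in>I. e k i * e k i) * (\<Sum>j\<in>J. w k j * w k j) else 0)"
    by (intro sum.cong refl) (use orth in auto)
  finally show ?thesis by (simp add: power2_eq_square)
qed

text \<open>The duality of spectral and nuclear norm, with the nuclear norm bounded by
  \<open>sqrt p\<close> times the Frobenius norm.\<close>

lemma inner_product_le_of_bilinear_bound:
  fixes A :: "'a \<Rightarrow> 'b \<Rightarrow> real" and a :: "nat \<Rightarrow> 'a \<Rightarrow> real"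
  assumes "finite I" and A: "bilinear_bound I J A s" and "0 \<le> s"
    and D: "\<And>i j. i \<in> I \<Longrightarrow> j \<in> J \<Longrightarrow> D i j = (\<Sum>l<p. a l i * b l j)"
  shows "(\<Sum>i\<in>I. \<Sum>j\<in>J. A i j * D i j) \<le> s * sqrt p * sqrt (\<Sum>i\<in>I. \<Sum>j\<in>J. (D i j)\<^sup>2)"
proof -
  obtain e :: "nat \<Rightarrow> 'a \<Rightarrow> real" and w :: "nat \<Rightarrow> 'b \<Rightarrow> real"
    where ew: "(\<forall>k<p. \<forall>l<p. k \<noteq> l \<longrightarrow> (\<Sum>i\<in>I. e k i * e l i) = 0) \<and>
           (\<forall>i\<in>I. \<forall>j. (\<Sum>l<p. a l i * b l j) = (\<Sum>l<p. e l i * w l j))"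
    using orthogonal_decomposition[OF \<open>finite I\<close>, of p a b] by (elim exE)
  have orth: "(\<Sum>i\<in>I. e k i * e l i) = 0" if "k < p" "l < p" "k \<noteq> l" for k l
    using ew that by simp
  have dec: "(\<Sum>l<p. a l i * b l j) = (\<Sum>l<p. e l i * w l j)" if "i \<in> I" for i j
    using ew that by simp
  have "(\<Sum>i\<in>I. \<Sum>j\<in>J. A i j * D i j) = (\<Sum>i\<in>I. \<Sum>j\<in>J. \<Sum>l<p. e l i * A i j * w l j)"
    by (intro sum.cong refl) (simp add: D dec sum_distrib_left mult_ac)
  also have "\<dots> = (\<Sum>l<p. \<Sum>i\<in>I. \<Sum>j\<in>J. e l i * A i j * w l j)"
    by (rule sum_rotate3)
  also have "\<dots> \<le> (\<Sum>l<p. s * L2_set (e l) I * L2_set (w l) J)"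
    using A by (intro sum_mono) (auto simp: bilinear_bound_def)
  \<comment> \<open>The factor 1 prepares Cauchy-Schwarz over \<open>l\<close>, which produces
    \<open>sqrt p\<close>; orthogonality then identifies the other factor with the Frobenius norm of
    \<open>D\<close>.\<close>
  also have "\<dots> = s * (\<Sum>l<p. 1 * (L2_set (e l) I * L2_set (w l) J))"
    by (simp add: sum_distrib_left mult.assoc)
  also have "\<dots> \<le> s * (L2_set (\<lambda>_. 1) {..<p} * L2_set (\<lambda>l. L2_set (e l) I * L2_set (w l) J) {..<p})"
    using \<open>0 \<le> s\<close> by (intro mult_left_mono L2_set_mult_ineq')
  also have "L2_set (\<lambda>l. L2_set (e l) I * L2_set (w l) J) {..<p} = sqrt (\<Sum>i\<in>I. \<Sum>j\<in>J. (D i j)\<^sup>2)"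
  proof -
    have "(\<Sum>i\<in>I. \<Sum>j\<in>J. (D i j)\<^sup>2) = (\<Sum>i\<in>I. \<Sum>j\<in>J. (\<Sum>l<p. e l i * w l j)\<^sup>2)"
      by (intro sum.cong refl) (simp add: D dec)
    then show ?thesis
      by (simp add: orthogonal_sum_squares[OF orth] L2_set_def power_mult_distrib sum_nonneg)
  qed
  finally show ?thesis
    by (simp add: L2_set_constant mult_ac)
qed

text \<open>A maximal independent set \<open>S\<close> of columns spans all columns and has at most
  \<open>r\<close> elements. Its vectors, enumerated by \<open>g\<close> and padded with zeros up to
  \<open>r\<close>, are the left factors; the coordinates of the columns are the right
  factors.\<close>

lemma rank_le_imp_sum_of_rank_one:
  assumes M: "M \<in> carrier_mat m n" and rank: "vec_space.rank m (M :: real mat) \<le> r"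
  shows "\<exists>a b. \<forall>i<m. \<forall>j<n. M $$ (i, j) = (\<Sum>l<r. a l i * b l j)"
proof -
  interpret vec_space "TYPE(real)" m .
  have cols: "set (cols M) \<subseteq> carrier_vec m"
    using M cols_dim by blast
  obtain S where S: "finite S" "maximal S (\<lambda>T. T \<subseteq> set (cols M) \<and> lin_indpt T)"
    using maximal_exists_superset[of "set (cols M)" "\<lambda>T. T \<subseteq> set (cols M) \<and> lin_indpt T" "{}"]
    by (auto simp: lin_dep_def)
  have card: "card S \<le> r"
    using rank_card_indpt[OF M S(2)] rank by simp
  have Scols: "S \<subseteq> set (cols M)" and indpt: "lin_indpt S"
    using S(2) unfolding maximal_def by auto
  have Sc: "S \<subseteq> carrier_vec m"
    using Scols cols by blast
  have in_span: "v \<in> span S" if "v \<in> set (cols M)" for v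
  proof (rule ccontr)
    assume v: "v \<notin> span S"
    have vS: "v \<notin> S"
      using v span_mem Sc by auto
    then have "lin_indpt (S \<union> {v})"
      using lin_dep_iff_in_span[OF Sc indpt _ vS] v that cols by auto
    then have "maximal S (\<lambda>T. T \<subseteq> set (cols M) \<and> lin_indpt T) \<Longrightarrow> S \<union> {v} = S"
      using that Scols unfolding maximal_def by blast
    then show False
      using S(2) vS by blast
  qed
  obtain g where g: "bij_betw g {..<card S} S"
    using ex_bij_betw_nat_finite[OF S(1)] by (auto simp: lessThan_atLeast0)
  have "\<exists>f. col M j = lincomb f S" if "j < n" for j
    using in_span[of "col M j"] that M finite_span[OF S(1)] Sc by (auto simp: cols_def)
  then obtain f where f: "\<And>j. j < n \<Longrightarrow> col M j = lincomb (f j) S"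
    by metis
  define a where "a l i = (if l < card S then g l $ i else 0)" for l i
  define b where "b l j = f j (g l)" for l j
  have "M $$ (i, j) = (\<Sum>l<r. a l i * b l j)" if "i < m" "j < n" for i j
  proof -
    have "M $$ (i, j) = col M j $ i"
      using that M by simp
    also have "\<dots> = (\<Sum>x\<in>S. f j x * x $ i)"
      unfolding f[OF that(2)] by (rule lincomb_index[OF that(1) Sc])
    also have "\<dots> = (\<Sum>l<card S. f j (g l) * g l $ i)"
      by (rule sum.reindex_bij_betw[OF g, symmetric])
    also have "\<dots> = (\<Sum>l<card S. a l i * b l j)"
      by (simp add: a_def b_def mult.commute)
    also have "\<dots> = (\<Sum>l<r. a l i * b l j)"
      using card by (intro sum.mono_neutral_left) (auto simp: a_def)
    finally show ?thesis .
  qed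
  then show ?thesis by (intro exI allI impI)
qed

section \<open>The second singular value\<close>

text \<open>Sylvester's identity: the two products of the block matrices \<open>?M\<close> and
  \<open>?N\<close> have equal determinants, and both are block lower triangular with one side of
  the claim as the determinant. With \<open>k = 1\<close> it evaluates rank-one
  perturbations.\<close>

lemma det_one_plus_mult_commute:
  fixes U V :: "'a :: idom mat"
  assumes U: "U \<in> carrier_mat n k" and V: "V \<in> carrier_mat k n"
  shows "det (1\<^sub>m n + U * V) = det (1\<^sub>m k + V * U)"
proof -
  let ?M = "four_block_mat (1\<^sub>m n) (- U) V (1\<^sub>m k)"
  let ?N = "four_block_mat (1\<^sub>m n) U (0\<^sub>m k n) (1\<^sub>m k)"
  have M: "?M \<in> carrier_mat (n + k) (n + k)" and N: "?N \<in> carrier_mat (n + k) (n + k)"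
    by auto
  have MN: "?M * ?N = four_block_mat (1\<^sub>m n) (0\<^sub>m n k) V (1\<^sub>m k + V * U)"
    using U V by (subst mult_four_block_mat[of _ n n _ k _ k _ _ n _ k])
      (auto intro!: cong_four_block_mat simp: comm_add_mat)
  have NM: "?N * ?M = four_block_mat (1\<^sub>m n + U * V) (0\<^sub>m n k) V (1\<^sub>m k)"
    using U V by (subst mult_four_block_mat[of _ n n _ k _ k _ _ n _ k])
      (auto intro!: cong_four_block_mat)
  have "det (?M * ?N) = det (?N * ?M)"
    by (simp only: det_mult[OF M N] det_mult[OF N M] mult.commute)
  then show ?thesis
    using U V unfolding MN NM
    by (subst (asm) det_four_block_mat_upper_right_zero[of _ n _ k], auto)
       (subst (asm) det_four_block_mat_upper_right_zero[of _ n _ k], auto)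
qed

text \<open>For \<open>x \<noteq> l\<close>, \<open>x I - H = (x I - A) (I + l / (x - l) v v\<^sup>T)\<close>, because \<open>v\<close> is an eigenvector.\<close>

lemma char_poly_deflation:
  fixes A :: "real mat" and v :: "nat \<Rightarrow> real"
  assumes A: "A \<in> carrier_mat n n"
    and v: "\<And>i. i < n \<Longrightarrow> (\<Sum>j<n. A $$ (i, j) * v j) = l * v i" and unit: "(\<Sum>i<n. v i * v i) = 1"
  defines "H \<equiv> Matrix.mat n n (\<lambda>(i, j). A $$ (i, j) - l * v i * v j)"
  shows "[:- l, 1:] * char_poly H = [:0, 1:] * char_poly A"
proof -
  have H: "H \<in> carrier_mat n n"
    by (simp add: H_def)
  have main: "(x - l) * poly (char_poly H) x = x * poly (char_poly A) x" if x: "x \<noteq> l" for x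
  proof -
    define c where "c = l / (x - l)"
    define U where "U = Matrix.mat n 1 (\<lambda>(i, j). c * v i)"
    define V where "V = Matrix.mat 1 n (\<lambda>(i, j). v j)"
    have UV: "U \<in> carrier_mat n 1" "V \<in> carrier_mat 1 n"
      by (auto simp: U_def V_def)
    have c: "c * (x - l) = l"
      using x by (simp add: c_def)
    have "- char_matrix H x = - char_matrix A x * (1\<^sub>m n + U * V)"
    proof (rule eq_matI)
      fix i j assume ij: "i < dim_row (- char_matrix A x * (1\<^sub>m n + U * V))"
        "j < dim_col (- char_matrix A x * (1\<^sub>m n + U * V))"
      then have i: "i < n" and j: "j < n"
        using A UV by (auto simp: char_matrix_def)
      have "(- char_matrix A x * (1\<^sub>m n + U * V)) $$ (i, j) =
          (\<Sum>k<n. (- (A $$ (i, k) + - x * (if i = k then 1 else 0))) * ((if k = j then 1 else 0) + c * v k * v j))"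
        using i j A UV
        by (auto simp: char_matrix_def scalar_prod_def U_def V_def lessThan_atLeast0 algebra_simps
            simp flip: sum_negf intro!: sum.cong)
      also have "\<dots> = (\<Sum>k<n. (if k = j then - A $$ (i, k) else 0) - c * v j * (A $$ (i, k) * v k)
          + (if k = i then (if i = j then x else 0) + x * c * v i * v j else 0))"
        by (intro sum.cong refl) (auto simp: algebra_simps)
      also have "\<dots> = - A $$ (i, j) - c * v j * (\<Sum>k<n. A $$ (i, k) * v k)
          + ((if i = j then x else 0) + x * c * v i * v j)"
        using i j by (simp add: sum.distrib sum_subtractf sum_distrib_left)
      also have "\<dots> = (if i = j then x else 0) - A $$ (i, j) + (c * (x - l)) * v i * v j"
        unfolding v[OF i] by (simp add: algebra_simps)
      also have "\<dots> = (- char_matrix H x) $$ (i, j)"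
        using i j H unfolding c by (auto simp: char_matrix_def H_def)
      finally show "(- char_matrix H x) $$ (i, j) = (- char_matrix A x * (1\<^sub>m n + U * V)) $$ (i, j)" ..
    qed (use A H UV in \<open>auto simp: char_matrix_def\<close>)
    then have "det (- char_matrix H x) = det (- char_matrix A x) * det (1\<^sub>m n + U * V)"
      using A UV by (simp add: det_mult[of _ n])
    \<comment> \<open>Here \<open>V * U\<close> is a 1 by 1 matrix, so the determinant is
      \<open>1 + c\<close>, which equals \<open>x / (x - l)\<close>.\<close>
    also have "det (1\<^sub>m n + U * V) = (1\<^sub>m 1 + V * U) $$ (0, 0)"
      using UV by (simp add: det_one_plus_mult_commute[OF UV] det_single)
    also have "\<dots> = 1 + c * (\<Sum>i<n. v i * v i)"
      by (simp add: U_def V_def scalar_prod_def lessThan_atLeast0 sum_distrib_left mult_ac)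
    finally have "poly (char_poly H) x = poly (char_poly A) x * (1 + c)"
      using char_poly_matrix[OF A] char_poly_matrix[OF H] unit by simp
    moreover have "(x - l) * (1 + c) = x"
      using c by (simp add: algebra_simps)
    ultimately show ?thesis
      by (metis mult.assoc mult.commute)
  qed
  \<comment> \<open>\<open>main\<close> leaves out the point \<open>l\<close>. A further factor
    vanishing there makes the polynomials agree everywhere, and is cancelled afterwards.\<close>
  have "[:- l, 1:] * ([:- l, 1:] * char_poly H) = [:- l, 1:] * ([:0, 1:] * char_poly A)"
  proof (subst poly_eq_poly_eq_iff[symmetric], rule ext)
    fix x
    show "poly ([:- l, 1:] * ([:- l, 1:] * char_poly H)) x = poly ([:- l, 1:] * ([:0, 1:] * char_poly A)) x"
      using main[of x] by (cases "x = l") (auto simp flip: left_diff_distrib)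
  qed
  then show ?thesis
    by (subst (asm) mult_left_cancel) auto
qed

text \<open>The supremum \<open>s\<close> of the Rayleigh quotient makes \<open>s I - A\<close> positive semidefinite.  If \<open>s I - A\<close>
  had an inverse, its quadratic form would be bounded away from 0 on the unit sphere, contrary to the
  choice of \<open>s\<close>.\<close>

lemma Rayleigh_Sup_root_char_poly:
  fixes A :: "real mat"
  assumes A: "A \<in> carrier_mat n n" and "0 < n"
    and sym: "\<And>i j. i < n \<Longrightarrow> j < n \<Longrightarrow> A $$ (i, j) = A $$ (j, i)"
  shows "\<exists>s. poly (char_poly A) s = 0 \<and>
    (\<forall>x. (\<Sum>i<n. \<Sum>j<n. x i * A $$ (i, j) * x j) \<le> s * (\<Sum>i<n. (x i)\<^sup>2))"
proof -
  define q where "q x = (\<Sum>i<n. \<Sum>j<n. x i * A $$ (i, j) * x j)" for x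
  define N where "N x = (\<Sum>i<n. (x i)\<^sup>2)" for x :: "nat \<Rightarrow> real"
  define a where "a = (\<Sum>i<n. \<Sum>j<n. \<bar>A $$ (i, j)\<bar>)"
  define S where "S = q ` {x. N x = 1}"
  define s where "s = Sup S"
  have N_nonneg: "0 \<le> N x" for x
    by (simp add: N_def sum_nonneg)
  have "(\<lambda>i. if i = 0 then 1 else 0) \<in> {x. N x = 1}"
    using \<open>0 < n\<close> by (simp add: N_def if_distrib[of "\<lambda>t. t ^ 2"] cong: if_cong)
  then have S_ne: "S \<noteq> {}"
    unfolding S_def by blast
  have q_scale: "q (\<lambda>i. c * x i) = c\<^sup>2 * q x" and N_scale: "N (\<lambda>i. c * x i) = c\<^sup>2 * N x" for c x
    by (simp_all add: q_def N_def power_mult_distrib sum_distrib_left power2_eq_square mult_ac)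
  have q_abs: "\<bar>q x\<bar> \<le> a * N x" for x
  proof -
    have "\<bar>q x\<bar> \<le> (\<Sum>i<n. \<Sum>j<n. \<bar>x i * A $$ (i, j) * x j\<bar>)"
      unfolding q_def by (intro order_trans[OF sum_abs] sum_mono sum_abs)
    also have "\<dots> \<le> (\<Sum>i<n. \<Sum>j<n. \<bar>A $$ (i, j)\<bar> * N x)"
    proof (intro sum_mono)
      fix i j assume "i \<in> {..<n}" "j \<in> {..<n}"
      then have "(x i)\<^sup>2 \<le> N x" "(x j)\<^sup>2 \<le> N x"
        unfolding N_def by (auto intro!: member_le_sum)
      then have "\<bar>x i\<bar> * \<bar>x j\<bar> \<le> sqrt (N x) * sqrt (N x)"
        by (intro mult_mono) (auto simp: real_le_rsqrt N_nonneg)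
      then show "\<bar>x i * A $$ (i, j) * x j\<bar> \<le> \<bar>A $$ (i, j)\<bar> * N x"
        using mult_left_mono[of "\<bar>x i\<bar> * \<bar>x j\<bar>" "N x" "\<bar>A $$ (i, j)\<bar>"] N_nonneg[of x]
        by (simp add: abs_mult mult_ac)
    qed
    finally show ?thesis
      by (simp add: a_def sum_distrib_right)
  qed
  have bdd: "bdd_above S"
  proof (rule bdd_aboveI)
    fix y assume "y \<in> S"
    then obtain x where x: "N x = 1" and y: "y = q x"
      unfolding S_def by auto
    then show "y \<le> a"
      using q_abs[of x] by simp
  qed
  have q_le: "q x \<le> s * N x" for x
  proof (cases "N x = 0")
    case True
    then show ?thesis using q_abs[of x] by simp
  next
    case False
    define c where "c = 1 / sqrt (N x)"
    have c: "c\<^sup>2 * N x = 1"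
      using False N_nonneg[of x] by (simp add: c_def power_divide)
    then have "q (\<lambda>i. c * x i) \<in> S"
      by (auto simp: S_def N_scale)
    then have "c\<^sup>2 * q x \<le> s"
      unfolding s_def using bdd cSup_upper by (metis q_scale)
    then have "c\<^sup>2 * q x * N x \<le> s * N x"
      using N_nonneg by (intro mult_right_mono) auto
    then show ?thesis
      using c by (metis mult.assoc mult.commute mult.left_commute mult_1)
  qed
  \<comment> \<open>\<open>y x\<close> is \<open>(s I - A) x\<close>, and \<open>b\<close> is the
    bilinear form of \<open>s I - A\<close>, which \<open>q_le\<close> makes positive
    semidefinite.\<close>
  define y where "y x i = s * x i - (\<Sum>j<n. A $$ (i, j) * x j)" for x i
  define b where "b x z = (\<Sum>i<n. y x i * z i)" for x z
  have bqq: "b x x = s * N x - q x" for x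
    by (simp add: b_def y_def q_def N_def algebra_simps sum_subtractf sum_distrib_left power2_eq_square)
  have b_sym: "b x z = b z x" for x z
  proof -
    have "(\<Sum>i<n. \<Sum>j<n. A $$ (i, j) * x j * z i) = (\<Sum>i<n. \<Sum>j<n. A $$ (i, j) * z j * x i)"
      by (subst sum.swap) (auto intro!: sum.cong simp: sym mult_ac)
    then show ?thesis
      by (simp add: b_def y_def algebra_simps sum_subtractf sum_distrib_left)
  qed
  have b_nonneg: "0 \<le> b x x" for x
    using q_le[of x] by (simp add: bqq)
  have y_lin: "y (\<lambda>i. x i + t * z i) i = y x i + t * y z i" for x z t i
    by (simp add: y_def algebra_simps sum.distrib sum_distrib_left)
  have b_quad: "b (\<lambda>i. x i + t * z i) (\<lambda>i. x i + t * z i) = b x x + 2 * t * b x z + t\<^sup>2 * b z z" for x z t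
  proof -
    have "b (\<lambda>i. x i + t * z i) (\<lambda>i. x i + t * z i) = b x x + t * b z x + t * b x z + t\<^sup>2 * b z z"
      unfolding b_def y_lin
      by (simp add: algebra_simps sum.distrib sum_distrib_left power2_eq_square)
    then show ?thesis by (simp add: b_sym[of z x])
  qed
  define K where "K = \<bar>s\<bar> + a"
  have b_le: "b x x \<le> K * N x" for x
  proof -
    have "s * N x \<le> \<bar>s\<bar> * N x"
      by (intro mult_right_mono N_nonneg) auto
    then show ?thesis
      using q_abs[of x] by (simp add: bqq K_def algebra_simps abs_le_iff)
  qed
  have a_nonneg: "0 \<le> a" by (simp add: a_def sum_nonneg)
  then have K_nonneg: "0 \<le> K" by (simp add: K_def)
  \<comment> \<open>The form is nonnegative at \<open>x + t * y x\<close> for every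
    \<open>t\<close>. Taking \<open>t = - 1 / K\<close> gives the bound; when \<open>K = 0\<close>
    the expression is affine in \<open>t\<close>, and a suitable \<open>t\<close> makes it -1 unless
    \<open>y x\<close> has norm 0.\<close>
  have N_y: "N (y x) \<le> K * b x x" for x
  proof -
    have xy: "b x (y x) = N (y x)"
      by (simp add: b_def N_def power2_eq_square)
    have *: "0 \<le> b x x + 2 * t * N (y x) + t\<^sup>2 * (K * N (y x))" for t
    proof -
      have "0 \<le> b x x + 2 * t * N (y x) + t\<^sup>2 * b (y x) (y x)"
        using b_nonneg[of "\<lambda>i. x i + t * y x i"] unfolding b_quad xy .
      also have "\<dots> \<le> b x x + 2 * t * N (y x) + t\<^sup>2 * (K * N (y x))"
        by (intro add_left_mono mult_left_mono b_le) auto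
      finally show ?thesis .
    qed
    show ?thesis
    proof (cases "K = 0")
      case True
      have "N (y x) \<le> 0"
      proof (rule ccontr)
        assume "\<not> N (y x) \<le> 0"
        then show False
          using *[of "- (b x x + 1) / (2 * N (y x))"] True by (simp add: field_simps)
      qed
      then show ?thesis using True by simp
    next
      case False
      then show ?thesis
        using *[of "- 1 / K"] K_nonneg by (simp add: field_simps power2_eq_square)
    qed
  qed
  have "poly (char_poly A) s = 0"
  proof (rule ccontr)
    assume "poly (char_poly A) s \<noteq> 0"
    then have det: "det (- char_matrix A s) \<noteq> 0"
      by (simp add: char_poly_matrix[OF A])
    let ?C = "- char_matrix A s"
    have C: "?C \<in> carrier_mat n n"
      using A by simp
    obtain B where B: "B \<in> carrier_mat n n" "B * ?C = 1\<^sub>m n"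
      using det_non_zero_imp_unit[OF C det] unfolding Units_def ring_mat_def by auto
    \<comment> \<open>The squared Frobenius norm of the inverse \<open>B\<close>: since
      \<open>x = B (y x)\<close>, it bounds \<open>N x\<close> in terms of
      \<open>N (y x)\<close>.\<close>
    define L where "L = (\<Sum>i<n. \<Sum>j<n. (B $$ (i, j))\<^sup>2)"
    have inv: "x i = (\<Sum>j<n. B $$ (i, j) * y x j)" if i: "i < n" for x i
    proof -
      have Ck: "?C $$ (j, k) * t = (if k = j then s * t else 0) - A $$ (j, k) * t" if "j < n" "k < n" for j k t
        using A that by (auto simp: char_matrix_def algebra_simps)
      have "(\<Sum>j<n. B $$ (i, j) * y x j) = (\<Sum>j<n. B $$ (i, j) * (\<Sum>k<n. ?C $$ (j, k) * x k))"
      proof (intro sum.cong refl arg_cong2[where f="(*)"])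
        fix j assume j: "j \<in> {..<n}"
        have "(\<Sum>k<n. ?C $$ (j, k) * x k) = (\<Sum>k<n. (if k = j then s * x j else 0) - A $$ (j, k) * x k)"
          by (intro sum.cong refl) (use j Ck in auto)
        then show "y x j = (\<Sum>k<n. ?C $$ (j, k) * x k)"
          using j by (simp add: y_def sum_subtractf)
      qed
      also have "\<dots> = (\<Sum>j<n. \<Sum>k<n. B $$ (i, j) * ?C $$ (j, k) * x k)"
        by (simp add: sum_distrib_left mult.assoc)
      also have "\<dots> = (\<Sum>k<n. (\<Sum>j<n. B $$ (i, j) * ?C $$ (j, k)) * x k)"
        by (subst sum.swap) (simp add: sum_distrib_right)
      also have "\<dots> = (\<Sum>k<n. (B * ?C) $$ (i, k) * x k)"
        using i B(1) C by (intro sum.cong refl arg_cong2[where f="(*)"])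
          (auto simp: scalar_prod_def lessThan_atLeast0 simp flip: sum_negf)
      also have "\<dots> = (\<Sum>k<n. if k = i then x i else 0)"
        unfolding B(2) using i by (intro sum.cong) auto
      finally show ?thesis using i by simp
    qed
    have "N x \<le> L * N (y x)" for x
    proof -
      have "N x = (\<Sum>i<n. (\<Sum>j<n. B $$ (i, j) * y x j)\<^sup>2)"
        unfolding N_def by (intro sum.cong refl) (use inv in \<open>metis lessThan_iff\<close>)
      also have "\<dots> \<le> (\<Sum>i<n. (\<Sum>j<n. (B $$ (i, j))\<^sup>2) * N (y x))"
        unfolding N_def by (intro sum_mono Cauchy_Schwarz_ineq_sum)
      finally show ?thesis
        by (simp add: L_def sum_distrib_right)
    qed
    moreover have "0 \<le> L"
      by (simp add: L_def sum_nonneg)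
    ultimately have NL: "N x \<le> L * (K * b x x)" for x
      using N_y[of x] by (meson mult_left_mono order_trans)
    \<comment> \<open>A gap below \<open>s\<close> that is uniform on the unit sphere contradicts
      \<open>s = Sup S\<close>. The added 1 keeps the denominator positive.\<close>
    have "q x \<le> s - 1 / (L * K + 1)" if "N x = 1" for x
    proof -
      have "1 \<le> (L * K) * (s - q x)"
        using NL[of x] that by (simp add: bqq mult.assoc)
      also have "\<dots> \<le> (L * K + 1) * (s - q x)"
        using q_le[of x] that by (intro mult_right_mono) auto
      finally have "1 \<le> (L * K + 1) * (s - q x)" .
      moreover have "0 < L * K + 1"
        using \<open>0 \<le> L\<close> K_nonneg by (simp add: add_nonneg_pos)
      ultimately show ?thesis
        by (simp add: field_simps)
    qed
    then have "s \<le> s - 1 / (L * K + 1)"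
      unfolding s_def by (intro cSup_least[OF S_ne]) (auto simp: S_def)
    moreover have "0 < L * K + 1"
      using \<open>0 \<le> L\<close> K_nonneg by (simp add: add_nonneg_pos)
    ultimately show False by simp
  qed
  moreover have "(\<Sum>i<n. \<Sum>j<n. x i * A $$ (i, j) * x j) \<le> s * (\<Sum>i<n. (x i)\<^sup>2)" for x
    using q_le unfolding q_def N_def .
  ultimately show ?thesis by (intro exI conjI allI)
qed


text \<open>If \<open>v\<close> is an eigenvector of \<open>G\<^sup>T * G\<close> for
  \<open>k\<close>, then \<open>k * (v \<bullet> v)\<close> is the squared norm of
  \<open>G v\<close>. The sign of \<open>k\<close> has to be settled because \<open>sqrt\<close> is
  negative on negative reals.\<close>

lemma singular_values_nonneg:
  fixes G :: "real mat"
  assumes "x \<in> set (singular_values G)"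
  shows "0 \<le> x"
proof -
  define n where "n = dim_col G"
  have G: "G \<in> carrier_mat (dim_row G) n" and GG: "G\<^sup>T * G \<in> carrier_mat n n"
    by (auto simp: n_def)
  have nz: "char_poly (G\<^sup>T * G) \<noteq> 0"
    using degree_monic_char_poly[OF GG] by auto
  obtain k where x: "x = sqrt k" and "poly (char_poly (G\<^sup>T * G)) k = 0"
    using assms nz by (auto simp: singular_values_def)
  then have "eigenvalue (G\<^sup>T * G) k"
    using eigenvalue_root_char_poly[OF GG] by simp
  then obtain v where v: "v \<in> carrier_vec n" "v \<noteq> 0\<^sub>v n" "G\<^sup>T * G *\<^sub>v v = k \<cdot>\<^sub>v v"
    unfolding eigenvalue_def eigenvector_def using GG by auto
  have GT: "G\<^sup>T \<in> carrier_mat n (dim_row G)"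
    by (simp add: n_def)
  have Gv: "G *\<^sub>v v \<in> carrier_vec (dim_row G)"
    by (rule mult_mat_vec_carrier[OF G v(1)])
  have "k * (v \<bullet> v) = (k \<cdot>\<^sub>v v) \<bullet> v"
    using v(1) by simp
  also have "\<dots> = (G\<^sup>T *\<^sub>v (G *\<^sub>v v)) \<bullet> v"
    unfolding v(3)[symmetric] assoc_mult_mat_vec[OF GT G v(1)] ..
  also have "\<dots> = (G *\<^sub>v v) \<bullet> (G *\<^sub>v v)"
    by (rule transpose_vec_mult_scalar[OF G v(1) Gv])
  finally have "0 \<le> k * (v \<bullet> v)"
    by (simp add: scalar_prod_def sum_nonneg)
  moreover obtain i where "i < n" "v $ i \<noteq> 0"
    using v(1,2) by (metis carrier_vecD eq_vecI index_zero_vec)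
  then have "0 < v \<bullet> v"
    using v(1) unfolding scalar_prod_def by (intro sum_pos2[of _ i]) (auto simp flip: power2_eq_square)
  ultimately show ?thesis
    using not_square_less_zero by (auto simp: x zero_le_mult_iff)
qed

lemma singular_value_nonneg: "0 \<le> singular_value G k"
  by (auto simp: singular_value_def intro!: singular_values_nonneg nth_mem)

text \<open>Multiset inclusion takes care of multiplicity: if \<open>t\<close> equals the first
  singular value, it has to occur a second time in the list.\<close>

lemma singular_value_2_ge:
  assumes "{#singular_value G 1, t#} \<subseteq># mset (singular_values G)"
  shows "t \<le> singular_value G 2"
proof -
  let ?xs = "singular_values G"
  have desc: "sorted_wrt (\<ge>) ?xs"
    by (simp add: singular_values_def sorted_wrt_rev)
  have len: "2 \<le> length ?xs"
    using size_mset_mono[OF assms] by simp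
  then obtain a b ys where xs: "?xs = a # b # ys"
    by (metis Suc_le_length_iff numeral_2_eq_2)
  have "singular_value G 1 = a" "singular_value G 2 = b"
    by (simp_all add: singular_value_def xs)
  moreover have "t \<in># mset (b # ys)"
    using assms unfolding xs \<open>singular_value G 1 = a\<close>
    by (simp add: insert_subset_eq_iff)
  ultimately show ?thesis
    using desc by (auto simp: xs)
qed

lemma bilinear_bound_of_sum_squares:
  fixes B :: "'a \<Rightarrow> 'b \<Rightarrow> real"
  assumes "0 \<le> s" and "\<And>x. (\<Sum>i\<in>I. (\<Sum>j\<in>J. B i j * x j)\<^sup>2) \<le> s\<^sup>2 * (\<Sum>j\<in>J. (x j)\<^sup>2)"
  shows "bilinear_bound I J B s"
  unfolding bilinear_bound_def
proof (intro allI)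
  fix x y
  have "(\<Sum>i\<in>I. \<Sum>j\<in>J. x i * B i j * y j) = (\<Sum>i\<in>I. x i * (\<Sum>j\<in>J. B i j * y j))"
    by (simp add: sum_distrib_left mult.assoc)
  also have "\<dots> \<le> L2_set x I * L2_set (\<lambda>i. \<Sum>j\<in>J. B i j * y j) I"
    by (rule L2_set_mult_ineq')
  also have "L2_set (\<lambda>i. \<Sum>j\<in>J. B i j * y j) I \<le> sqrt (s\<^sup>2 * (\<Sum>j\<in>J. (y j)\<^sup>2))"
    unfolding L2_set_def using assms(2) by simp
  then have "L2_set x I * L2_set (\<lambda>i. \<Sum>j\<in>J. B i j * y j) I \<le> L2_set x I * (s * L2_set y J)"
    using \<open>0 \<le> s\<close> by (intro mult_left_mono) (simp_all add: L2_set_def real_sqrt_mult sum_nonneg)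
  finally show "(\<Sum>i\<in>I. \<Sum>j\<in>J. x i * B i j * y j) \<le> s * L2_set x I * L2_set y J"
    by (simp add: mult_ac)
qed

text \<open>For \<open>B = G - s u v\<^sup>T\<close> the Gram matrix is
  \<open>H = G\<^sup>T G - s\<^sup>2 v v\<^sup>T\<close>. Its Rayleigh bound \<open>t\<close> is a
  root of its characteristic polynomial, and deflation makes a nonzero \<open>t\<close> an
  eigenvalue of \<open>G\<^sup>T G\<close> besides \<open>s\<^sup>2\<close>.\<close>

lemma bilinear_bound_second_singular_value:
  fixes G :: "real mat" and u v :: "nat \<Rightarrow> real"
  assumes G: "G \<in> carrier_mat m n" and "0 < n"
    and s: "s = singular_value G 1" "0 < s"
    and unit: "(\<Sum>i<m. u i * u i) = 1" "(\<Sum>j<n. v j * v j) = 1"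
    and Gv: "\<And>i. i < m \<Longrightarrow> (\<Sum>j<n. G $$ (i, j) * v j) = s * u i"
    and Gu: "\<And>j. j < n \<Longrightarrow> (\<Sum>i<m. G $$ (i, j) * u i) = s * v j"
  shows "bilinear_bound {..<m} {..<n} (\<lambda>i j. G $$ (i, j) - s * u i * v j) (singular_value G 2)"
proof -
  define A where "A = G\<^sup>T * G"
  define H where "H = Matrix.mat n n (\<lambda>(i, j). A $$ (i, j) - s\<^sup>2 * v i * v j)"
  define B where "B i j = G $$ (i, j) - s * u i * v j" for i j
  have A: "A \<in> carrier_mat n n" and H: "H \<in> carrier_mat n n"
    using G by (auto simp: A_def H_def)
  have A_ij: "A $$ (i, j) = (\<Sum>k<m. G $$ (k, i) * G $$ (k, j))" if "i < n" "j < n" for i j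
    using G that by (auto simp: A_def scalar_prod_def lessThan_atLeast0 intro!: sum.cong)
  have Av: "(\<Sum>j<n. A $$ (i, j) * v j) = s\<^sup>2 * v i" if i: "i < n" for i
  proof -
    have "(\<Sum>j<n. A $$ (i, j) * v j) = (\<Sum>j<n. \<Sum>k<m. G $$ (k, i) * (G $$ (k, j) * v j))"
      using i by (simp add: A_ij sum_distrib_right mult.assoc)
    also have "\<dots> = (\<Sum>k<m. G $$ (k, i) * (\<Sum>j<n. G $$ (k, j) * v j))"
      by (subst sum.swap) (simp add: sum_distrib_left)
    also have "\<dots> = (\<Sum>k<m. G $$ (k, i) * (s * u k))"
      by (intro sum.cong refl) (simp add: Gv)
    also have "\<dots> = s * (\<Sum>k<m. G $$ (k, i) * u k)"
      by (simp add: sum_distrib_left mult_ac)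
    finally show ?thesis
      by (simp add: Gu[OF i] power2_eq_square)
  qed
  have H_ij: "H $$ (i, j) = (\<Sum>k<m. B k i * B k j)" if "i < n" "j < n" for i j
  proof -
    have "(\<Sum>k<m. B k i * B k j) = A $$ (i, j) - s * v i * (\<Sum>k<m. G $$ (k, j) * u k)
        - s * v j * (\<Sum>k<m. G $$ (k, i) * u k) + s\<^sup>2 * v i * v j * (\<Sum>k<m. u k * u k)"
      by (simp add: B_def A_ij that algebra_simps sum.distrib sum_subtractf sum_distrib_left power2_eq_square)
    then show ?thesis
      using that by (simp add: H_def Gu unit power2_eq_square)
  qed
  have H_sym: "H $$ (i, j) = H $$ (j, i)" if "i < n" "j < n" for i j
    using that by (simp add: H_ij mult.commute)
  have "\<exists>t. poly (char_poly H) t = 0 \<and>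
      (\<forall>x. (\<Sum>i<n. \<Sum>j<n. x i * H $$ (i, j) * x j) \<le> t * (\<Sum>i<n. (x i)\<^sup>2))"
    by (rule Rayleigh_Sup_root_char_poly[OF H \<open>0 < n\<close>]) (rule H_sym)
  then obtain t where Ht: "poly (char_poly H) t = 0 \<and>
      (\<forall>x. (\<Sum>i<n. \<Sum>j<n. x i * H $$ (i, j) * x j) \<le> t * (\<Sum>i<n. (x i)\<^sup>2))"
    by (elim exE)
  then have root: "poly (char_poly H) t = 0" by (rule conjunct1)
  have t: "(\<Sum>i<n. \<Sum>j<n. x i * H $$ (i, j) * x j) \<le> t * (\<Sum>i<n. (x i)\<^sup>2)" for x
    using conjunct2[OF Ht] by (rule spec)
  have sq: "(\<Sum>k<m. (\<Sum>j<n. B k j * x j)\<^sup>2) \<le> t * (\<Sum>j<n. (x j)\<^sup>2)" for x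
  proof -
    have "(\<Sum>k<m. (\<Sum>j<n. B k j * x j)\<^sup>2) = (\<Sum>k<m. \<Sum>i<n. \<Sum>j<n. x i * (B k i * B k j) * x j)"
      by (simp add: power2_eq_square sum_product mult_ac)
    also have "\<dots> = (\<Sum>i<n. \<Sum>j<n. \<Sum>k<m. x i * (B k i * B k j) * x j)"
      by (rule sum_rotate3[symmetric])
    also have "\<dots> = (\<Sum>i<n. \<Sum>j<n. x i * H $$ (i, j) * x j)"
      by (intro sum.cong refl) (simp add: H_ij sum_distrib_left sum_distrib_right)
    finally show ?thesis using t by simp
  qed
  have t_nonneg: "0 \<le> t"
  proof -
    have "0 \<le> (\<Sum>k<m. (\<Sum>j<n. B k j * v j)\<^sup>2)" by (intro sum_nonneg) auto
    then show ?thesis using sq[of v] unit by (simp add: power2_eq_square)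
  qed
  have "sqrt t \<le> singular_value G 2"
  proof (cases "t = 0")
    case True
    then show ?thesis by (simp add: singular_value_nonneg)
  next
    case False
    have nzA: "char_poly A \<noteq> 0" and nzH: "char_poly H \<noteq> 0"
      using degree_monic_char_poly[OF A] degree_monic_char_poly[OF H] by auto
    have "proots ([:- s\<^sup>2, 1:] * char_poly H) = proots ([:0, 1:] * char_poly A)"
      using char_poly_deflation[OF A, of v "s\<^sup>2"] Av unit unfolding H_def by simp
    then have "add_mset (s\<^sup>2) (proots (char_poly H)) = add_mset 0 (proots (char_poly A))"
      using nzA nzH by (subst (asm) (1 2) proots_mult) auto
    moreover have "{#t#} \<subseteq># proots (char_poly H)"
      using root nzH by simp
    then have "add_mset (s\<^sup>2) {#t#} \<subseteq># add_mset (s\<^sup>2) (proots (char_poly H))"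
      by (simp only: mset_subset_eq_add_mset_cancel)
    ultimately have sub: "{#s\<^sup>2, t#} \<subseteq># add_mset 0 (proots (char_poly A))"
      by simp
    have "{#s\<^sup>2, t#} \<subseteq># proots (char_poly A)"
    proof (rule mset_subset_eqI)
      fix a
      show "count {#s\<^sup>2, t#} a \<le> count (proots (char_poly A)) a"
        using mset_subset_eq_count[OF sub, of a] s(2) False by (cases "a = 0") auto
    qed
    then have "image_mset sqrt {#s\<^sup>2, t#} \<subseteq># mset (singular_values G)"
      unfolding singular_values_def A_def by (simp only: mset_rev mset_sorted_list_of_multiset image_mset_subseteq_mono)
    then show ?thesis
      using s by (intro singular_value_2_ge) simp
  qed
  then have t_le: "t \<le> (singular_value G 2)\<^sup>2"
    using power_mono[of "sqrt t" _ 2] t_nonneg by simp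
  have "(\<Sum>k<m. (\<Sum>j<n. B k j * x j)\<^sup>2) \<le> (singular_value G 2)\<^sup>2 * (\<Sum>j<n. (x j)\<^sup>2)" for x
  proof -
    have "t * (\<Sum>j<n. (x j)\<^sup>2) \<le> (singular_value G 2)\<^sup>2 * (\<Sum>j<n. (x j)\<^sup>2)"
      by (rule mult_right_mono[OF t_le]) (simp add: sum_nonneg)
    then show ?thesis using sq[of x] by linarith
  qed
  then have "bilinear_bound {..<m} {..<n} B (singular_value G 2)"
    by (rule bilinear_bound_of_sum_squares[OF singular_value_nonneg])
  then show ?thesis
    unfolding B_def .
qed

section \<open>The spectral norm of a random matrix\<close>

text \<open>Integer points of an l1 ball. After scaling by \<open>1 / (4 * sqrt k)\<close> that ball
  contains the Euclidean unit ball, because the l1 norm is at most \<open>sqrt k\<close> times the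
  l2 norm. The l1 constraint is what makes counting by exponential weights possible.\<close>

definition grid :: "nat \<Rightarrow> (nat \<Rightarrow> int) set" where
  "grid k = {z \<in> {..<k} \<rightarrow>\<^sub>E {- int (4 * k)..int (4 * k)}. (\<Sum>i<k. \<bar>z i\<bar>) \<le> int (4 * k)}"

definition grid_point :: "nat \<Rightarrow> (nat \<Rightarrow> int) \<Rightarrow> nat \<Rightarrow> real" where
  "grid_point k z i = of_int (z i) / (4 * sqrt (real k))"

lemma grid_subset: "grid k \<subseteq> {..<k} \<rightarrow>\<^sub>E {- int (4 * k)..int (4 * k)}"
  unfolding grid_def by (rule Collect_restrict)

lemma finite_grid: "finite (grid k)"
  by (rule finite_subset[OF grid_subset finite_PiE]) simp_all

text \<open>The limit 7 is \<open>(1 + q) / (1 - q)\<close> for \<open>q = 3 / 4\<close>; only the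
  upper bound 7 matters for counting the grid.\<close>

lemma sum_geometric_symmetric:
  "(\<Sum>y\<in>{- int N..int N}. (3 / 4 :: real) ^ nat \<bar>y\<bar>) = 7 - 6 * (3 / 4) ^ N"
proof (induction N)
  case 0
  show ?case by simp
next
  case (Suc N)
  have "{- int (Suc N)..int (Suc N)} = insert (- int (Suc N)) (insert (int (Suc N)) {- int N..int N})"
    by auto
  moreover have "nat \<bar>int (Suc N)\<bar> = Suc N" "nat \<bar>- int (Suc N)\<bar> = Suc N"
    by simp_all
  ultimately show ?case
    using Suc by (simp del: of_nat_Suc)
qed

text \<open>Exponential weighting: every grid vector has weight at least \<open>(3/4) ^ (4 * k)\<close> in the product
  of \<open>k\<close> geometric sums.\<close>

lemma card_grid_le: "real (card (grid k)) \<le> (1792 / 81) ^ k"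
proof -
  let ?P = "{..<k} \<rightarrow>\<^sub>E {- int (4 * k)..int (4 * k)}"
  have "real (card (grid k)) * (3 / 4) ^ (4 * k) = (\<Sum>z\<in>grid k. (3 / 4) ^ (4 * k))"
    by simp
  also have "\<dots> \<le> (\<Sum>z\<in>grid k. \<Prod>i<k. (3 / 4) ^ nat \<bar>z i\<bar>)"
  proof (rule sum_mono)
    fix z assume "z \<in> grid k"
    then have "(\<Sum>i<k. \<bar>z i\<bar>) \<le> int (4 * k)"
      by (simp add: grid_def)
    moreover have "int (\<Sum>i<k. nat \<bar>z i\<bar>) = (\<Sum>i<k. \<bar>z i\<bar>)"
      by simp
    ultimately have "(\<Sum>i<k. nat \<bar>z i\<bar>) \<le> 4 * k"
      by linarith
    then show "(3 / 4 :: real) ^ (4 * k) \<le> (\<Prod>i<k. (3 / 4) ^ nat \<bar>z i\<bar>)"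
      by (simp add: power_decreasing flip: power_sum)
  qed
  also have "\<dots> \<le> (\<Sum>z\<in>?P. \<Prod>i<k. (3 / 4) ^ nat \<bar>z i\<bar>)"
    by (rule sum_mono2[OF _ grid_subset]) (simp_all add: finite_PiE prod_nonneg)
  also have "\<dots> = (\<Prod>i<k. \<Sum>y\<in>{- int (4 * k)..int (4 * k)}. (3 / 4) ^ nat \<bar>y\<bar>)"
    by (rule prod_sum_PiE[symmetric]) simp_all
  also have "\<dots> \<le> (\<Prod>i<k. 7)"
    by (intro prod_mono conjI sum_nonneg) (simp_all only: sum_geometric_symmetric, simp_all)
  finally have "real (card (grid k)) * (3 / 4) ^ (4 * k) \<le> 7 ^ k"
    by simp
  \<comment> \<open>The base \<open>1792 / 81\<close> is \<open>7 * (4 / 3) ^ 4\<close>.\<close>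
  also have "(7 :: real) ^ k = ((1792 / 81) * (3 / 4) ^ 4) ^ k"
    by (simp add: eval_nat_numeral)
  also have "\<dots> = (1792 / 81) ^ k * (3 / 4) ^ (4 * k)"
    by (simp only: power_mult_distrib power_mult)
  finally show ?thesis by simp
qed

lemma L2_set_mono_abs:
  assumes "\<And>i. i \<in> K \<Longrightarrow> \<bar>f i\<bar> \<le> \<bar>g i\<bar>"
  shows "L2_set f K \<le> L2_set g K"
  unfolding L2_set_def using assms by (auto intro!: sum_mono simp: abs_le_square_iff)

text \<open>Rounding \<open>c * x i\<close> towards 0 does not increase absolute values, so the
  point stays in the unit ball. Each coordinate moves by at most \<open>1 / c\<close>, hence the
  vector by at most \<open>sqrt k / c = 1 / 4\<close>.\<close>

lemma grid_approximation:
  assumes k: "0 < k" and x: "L2_set x {..<k} \<le> 1"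
  obtains z where "z \<in> grid k" "L2_set (grid_point k z) {..<k} \<le> 1"
    "L2_set (\<lambda>i. x i - grid_point k z i) {..<k} \<le> 1 / 4"
proof -
  define c where "c = 4 * sqrt (real k)"
  have c: "0 < c" using k by (simp add: c_def)
  define z where "z = (\<lambda>i\<in>{..<k}. if 0 \<le> x i then \<lfloor>c * x i\<rfloor> else \<lceil>c * x i\<rceil>)"
  have z: "\<bar>of_int (z i)\<bar> \<le> c * \<bar>x i\<bar> \<and> \<bar>c * x i - of_int (z i)\<bar> \<le> 1" if "i < k" for i
  proof (cases "0 \<le> x i")
    case True
    then have "0 \<le> c * x i" using c by simp
    then have "0 \<le> \<lfloor>c * x i\<rfloor>" by simp
    with True show ?thesis
      using that of_int_floor_le[of "c * x i"] by (simp add: z_def) linarith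
  next
    case False
    then have "c * x i \<le> 0" using c by (simp add: mult_le_0_iff)
    then have "\<lceil>c * x i\<rceil> \<le> 0" by simp
    with False show ?thesis
      using that le_of_int_ceiling[of "c * x i"] by (simp add: z_def) linarith
  qed
  have gp: "grid_point k z i = of_int (z i) / c" for i
    by (simp add: grid_point_def c_def)
  have "real_of_int (\<Sum>i<k. \<bar>z i\<bar>) \<le> (\<Sum>i<k. c * \<bar>x i\<bar>)"
    using z by (auto intro!: sum_mono)
  also have "\<dots> = c * (\<Sum>i<k. \<bar>x i\<bar> * 1)"
    by (simp add: sum_distrib_left)
  also have "\<dots> \<le> c * (L2_set (\<lambda>i. \<bar>x i\<bar>) {..<k} * L2_set (\<lambda>_. 1) {..<k})"
    using c by (intro mult_left_mono L2_set_mult_ineq') auto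
  also have "\<dots> \<le> c * (1 * L2_set (\<lambda>_. 1) {..<k})"
    using c x by (intro mult_left_mono mult_right_mono) (auto simp: L2_set_def)
  also have "\<dots> = real_of_int (int (4 * k))"
    by (simp add: c_def L2_set_constant)
  finally have sum: "(\<Sum>i<k. \<bar>z i\<bar>) \<le> int (4 * k)"
    by (simp only: of_int_le_iff)
  have "\<bar>z i\<bar> \<le> int (4 * k)" if "i < k" for i
    using sum member_le_sum[of i "{..<k}" "\<lambda>i. \<bar>z i\<bar>"] that by auto
  then have "z \<in> {..<k} \<rightarrow>\<^sub>E {- int (4 * k)..int (4 * k)}"
    by (auto simp: z_def abs_le_iff PiE_iff) (smt (verit))+
  then have "z \<in> grid k"
    using sum by (simp add: grid_def)
  moreover have "L2_set (grid_point k z) {..<k} \<le> L2_set x {..<k}"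
    using z c by (intro L2_set_mono_abs) (simp add: gp divide_le_eq mult.commute)
  moreover have "L2_set (\<lambda>i. x i - grid_point k z i) {..<k} \<le> L2_set (\<lambda>_. 1 / c) {..<k}"
  proof (rule L2_set_mono_abs)
    fix i assume "i \<in> {..<k}"
    moreover have "x i - grid_point k z i = (c * x i - of_int (z i)) / c"
      using c by (simp add: gp field_simps)
    ultimately show "\<bar>x i - grid_point k z i\<bar> \<le> \<bar>1 / c\<bar>"
      using z c by (simp add: divide_right_mono)
  qed
  moreover have "L2_set (\<lambda>_. 1 / c) {..<k} = 1 / 4"
    using k by (simp add: L2_set_constant c_def)
  ultimately show thesis
    using x that by force
qed

text \<open>With \<open>s\<close> the supremum of the form over the unit balls, rounding both arguments to the grid
  costs at most \<open>s / 4\<close> each, hence \<open>s \<le> t + s / 2\<close>.\<close>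

lemma bilinear_bound_of_grid:
  fixes A :: "nat \<Rightarrow> nat \<Rightarrow> real"
  assumes m: "0 < m" and n: "0 < n"
    and net: "\<And>z z'. z \<in> grid m \<Longrightarrow> z' \<in> grid n \<Longrightarrow> L2_set (grid_point m z) {..<m} \<le> 1 \<Longrightarrow>
      L2_set (grid_point n z') {..<n} \<le> 1 \<Longrightarrow>
      (\<Sum>i<m. \<Sum>j<n. grid_point m z i * A i j * grid_point n z' j) \<le> t"
  shows "bilinear_bound {..<m} {..<n} A (2 * t)"
proof -
  define f where "f x y = (\<Sum>i<m. \<Sum>j<n. x i * A i j * y j)" for x y :: "nat \<Rightarrow> real"
  define S where "S = {f x y | x y. L2_set x {..<m} \<le> 1 \<and> L2_set y {..<n} \<le> 1}"
  define s where "s = Sup S"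
  have "f (\<lambda>_. 0) (\<lambda>_. 0) \<in> S"
    unfolding S_def by (auto simp: L2_set_def intro!: exI[of _ "\<lambda>_. 0"])
  then have S_ne: "S \<noteq> {}" by blast
  have f_le: "f x y \<le> (\<Sum>i<m. \<Sum>j<n. \<bar>A i j\<bar>)" if xy: "L2_set x {..<m} \<le> 1" "L2_set y {..<n} \<le> 1" for x y
    unfolding f_def
  proof (intro sum_mono)
    fix i j assume ij: "i \<in> {..<m}" "j \<in> {..<n}"
    have "\<bar>x i\<bar> \<le> L2_set (\<lambda>i. \<bar>x i\<bar>) {..<m}" "\<bar>y j\<bar> \<le> L2_set (\<lambda>j. \<bar>y j\<bar>) {..<n}"
      using ij by (auto intro!: member_le_L2_set)
    moreover have "L2_set (\<lambda>i. \<bar>x i\<bar>) {..<m} = L2_set x {..<m}"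
      "L2_set (\<lambda>j. \<bar>y j\<bar>) {..<n} = L2_set y {..<n}"
      by (simp_all add: L2_set_def)
    ultimately have "\<bar>x i\<bar> \<le> 1" "\<bar>y j\<bar> \<le> 1"
      using xy by linarith+
    then have "\<bar>x i\<bar> * \<bar>A i j\<bar> * \<bar>y j\<bar> \<le> 1 * \<bar>A i j\<bar> * 1"
      by (intro mult_mono) auto
    then show "x i * A i j * y j \<le> \<bar>A i j\<bar>"
      by (simp flip: abs_mult)
  qed
  have bdd: "bdd_above S"
    by (rule bdd_aboveI[of _ "\<Sum>i<m. \<Sum>j<n. \<bar>A i j\<bar>"]) (auto simp: S_def intro!: f_le)
  have f_s: "f x y \<le> s" if "L2_set x {..<m} \<le> 1" "L2_set y {..<n} \<le> 1" for x y
    unfolding s_def using that by (intro cSup_upper bdd) (auto simp: S_def)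
  have f_scale: "f (\<lambda>i. a * x i) (\<lambda>j. b * y j) = a * b * f x y" for a b x y
    by (simp add: f_def sum_distrib_left mult_ac)
  have L2_scale: "L2_set (\<lambda>i. a * x i) K = \<bar>a\<bar> * L2_set x K" for a x and K :: "nat set"
    by (simp add: L2_set_def power_mult_distrib real_sqrt_mult flip: sum_distrib_left)
  have "f x y \<le> t + s / 2" if x: "L2_set x {..<m} \<le> 1" and y: "L2_set y {..<n} \<le> 1" for x y
  proof -
    obtain z where z: "z \<in> grid m" "L2_set (grid_point m z) {..<m} \<le> 1"
      "L2_set (\<lambda>i. x i - grid_point m z i) {..<m} \<le> 1 / 4"
      by (rule grid_approximation[OF m x])
    obtain z' where z': "z' \<in> grid n" "L2_set (grid_point n z') {..<n} \<le> 1"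
      "L2_set (\<lambda>i. y i - grid_point n z' i) {..<n} \<le> 1 / 4"
      by (rule grid_approximation[OF n y])
    \<comment> \<open>Multiplication by 4 brings the rounding error back into the unit ball, where
      \<open>s\<close> bounds the form.\<close>
    have "4 * 1 * f (\<lambda>i. x i - grid_point m z i) (grid_point n z') \<le> s"
      unfolding f_scale[symmetric] using z z' by (intro f_s) (simp_all add: L2_scale del: right_diff_distrib_numeral)
    moreover have "1 * 4 * f x (\<lambda>i. y i - grid_point n z' i) \<le> s"
      unfolding f_scale[symmetric] using x z' by (intro f_s) (simp_all add: L2_scale del: right_diff_distrib_numeral)
    moreover have "f (grid_point m z) (grid_point n z') \<le> t"
      unfolding f_def by (intro net z z')
    moreover have "f x y = f (grid_point m z) (grid_point n z')
        + f (\<lambda>i. x i - grid_point m z i) (grid_point n z') + f x (\<lambda>i. y i - grid_point n z' i)"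
      by (simp add: f_def algebra_simps flip: sum.distrib)
    ultimately show ?thesis by linarith
  qed
  then have "s \<le> t + s / 2"
    unfolding s_def by (intro cSup_least[OF S_ne]) (auto simp: S_def)
  then have s_t: "s \<le> 2 * t" by simp
  show ?thesis
    unfolding bilinear_bound_def
  proof (intro allI)
    fix x y
    let ?a = "L2_set x {..<m}" and ?b = "L2_set y {..<n}"
    have "f x y \<le> 2 * t * ?a * ?b"
    proof (cases "?a = 0 \<or> ?b = 0")
      case True
      then have "f x y = 0"
        by (auto simp: f_def L2_set_eq_0_iff)
      then show ?thesis using True by auto
    next
      case False
      then have ab: "0 < ?a" "0 < ?b"
        using L2_set_nonneg by (metis less_eq_real_def)+
      then have "f (\<lambda>i. 1 / ?a * x i) (\<lambda>j. 1 / ?b * y j) \<le> 2 * t"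
        by (intro order_trans[OF f_s s_t]) (simp_all only: L2_scale, simp_all)
      then show ?thesis
        using ab unfolding f_scale by (simp add: field_simps)
    qed
    then show "(\<Sum>i<m. \<Sum>j<n. x i * A i j * y j) \<le> 2 * t * ?a * ?b"
      by (simp add: f_def)
  qed
qed

text \<open>The summand \<open>c i * score i (Y i)\<close> ranges over an interval of length
  \<open>\<bar>c i\<bar> * L\<close>, so the squared lengths add up to at most
  \<open>L\<^sup>2\<close>.\<close>

lemma Hoeffding_Pi_pmf:
  fixes score :: "'a \<Rightarrow> 'b \<Rightarrow> real"
  assumes fin: "finite I" and "0 < L" "0 \<le> t"
    and c: "(\<Sum>i\<in>I. (c i)\<^sup>2) \<le> 1"
    and mean: "\<And>i. i \<in> I \<Longrightarrow> measure_pmf.expectation (p i) (score i) = 0"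
    and range: "\<And>i y. i \<in> I \<Longrightarrow> y \<in> set_pmf (p i) \<Longrightarrow> score i y \<in> {a i..a i + L}"
  shows "measure_pmf.prob (Pi_pmf I dflt p) {Y. t < (\<Sum>i\<in>I. c i * score i (Y i))}
      \<le> exp (- 2 * t\<^sup>2 / L\<^sup>2)"
proof -
  define M where "M = Pi_pmf I dflt p"
  define X where "X i Y = c i * score i (Y i)" for i and Y :: "'a \<Rightarrow> 'b"
  \<comment> \<open>A negative \<open>c i\<close> exchanges the endpoints, hence the minimum and
    maximum.\<close>
  define lo where "lo i = min (c i * a i) (c i * (a i + L))" for i
  define hi where "hi i = max (c i * a i) (c i * (a i + L))" for i
  have width: "(hi i - lo i)\<^sup>2 = (c i)\<^sup>2 * L\<^sup>2" for i
    by (auto simp: hi_def lo_def max_def min_def algebra_simps power2_eq_square)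
  have comp: "map_pmf (\<lambda>Y. Y i) M = p i" if "i \<in> I" for i
    using Pi_pmf_component[OF fin, of i dflt p] that by (simp add: M_def)
  interpret Hoeffding_ineq "measure_pmf M" I X lo hi "\<Sum>i\<in>I. measure_pmf.expectation M (X i)"
  proof unfold_locales
    show "prob_space.indep_vars (measure_pmf M) (\<lambda>_. borel) X I"
      unfolding X_def M_def
      by (rule prob_space.indep_vars_compose2[OF measure_pmf.prob_space_axioms indep_vars_Pi_pmf[OF fin]])
        auto
  next
    fix i assume i: "i \<in> I"
    have "X i Y \<in> {lo i..hi i}" if Y: "Y \<in> set_pmf M" for Y
    proof -
      have "Y i \<in> set_pmf (p i)"
        using Y by (simp flip: comp[OF i])
      from range[OF i this] show ?thesis
        unfolding X_def lo_def hi_def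
        by (cases "0 \<le> c i") (auto simp: min_le_iff_disj le_max_iff_disj mult_left_mono mult_left_mono_neg)
    qed
    then show "AE Y in measure_pmf M. X i Y \<in> {lo i..hi i}"
      by (simp add: AE_measure_pmf_iff)
  qed (use fin in auto)
  have "measure_pmf.expectation M (X i) = 0" if i: "i \<in> I" for i
  proof -
    have "measure_pmf.expectation M (X i) = measure_pmf.expectation (map_pmf (\<lambda>Y. Y i) M) (\<lambda>y. c i * score i y)"
      by (simp add: X_def[abs_def])
    then show ?thesis
      using mean[OF i] by (simp add: comp[OF i])
  qed
  then have mu: "(\<Sum>i\<in>I. measure_pmf.expectation M (X i)) = 0"
    by simp
  let ?d = "\<Sum>i\<in>I. (hi i - lo i)\<^sup>2"
  have d: "?d = (\<Sum>i\<in>I. (c i)\<^sup>2) * L\<^sup>2"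
    by (simp add: width sum_distrib_right)
  show ?thesis
  proof (cases "0 < ?d")
    case True
    have "measure_pmf.prob M {Y. t < (\<Sum>i\<in>I. X i Y)} \<le> measure_pmf.prob M {Y. (\<Sum>i\<in>I. X i Y) \<ge> t}"
      by (intro measure_pmf.finite_measure_mono) auto
    also have "\<dots> \<le> exp (- 2 * t\<^sup>2 / ?d)"
      using Hoeffding_ineq_ge[OF \<open>0 \<le> t\<close> True] unfolding mu by simp
    also have "\<dots> \<le> exp (- 2 * t\<^sup>2 / L\<^sup>2)"
    proof -
      have "?d \<le> 1 * L\<^sup>2"
        unfolding d by (intro mult_right_mono c) auto
      then have "2 * t\<^sup>2 / L\<^sup>2 \<le> 2 * t\<^sup>2 / ?d"
        using True \<open>0 < L\<close> by (intro divide_left_mono) auto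
      then show ?thesis by simp
    qed
    finally show ?thesis by (simp add: M_def X_def)
  \<comment> \<open>Hoeffding's inequality needs a positive total width. Otherwise all
    \<open>c i\<close> vanish and the event, defined by a strict inequality, is empty.\<close>
  next
    case False
    then have "(\<Sum>i\<in>I. (c i)\<^sup>2) \<le> 0"
      using \<open>0 < L\<close> unfolding d by (simp add: zero_less_mult_iff)
    then have "(\<Sum>i\<in>I. (c i)\<^sup>2) = 0"
      by (simp add: sum_nonneg order_antisym)
    then have "\<forall>i\<in>I. c i = 0"
      using fin by (simp add: sum_nonneg_eq_0_iff)
    then show ?thesis using \<open>0 \<le> t\<close> by simp
  qed
qed

text \<open>A union bound over pairs of grid points: there are at most \<open>exp (10 * m)\<close>
  pairs, and each one fails with probability at most \<open>exp (- 11 * m)\<close>.\<close>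

lemma prob_bilinear_bound:
  fixes score :: "nat \<times> nat \<Rightarrow> 'b \<Rightarrow> real"
  assumes n: "0 < n" "n \<le> m" and Om: "\<Omega> \<subseteq> {..<m} \<times> {..<n}" and L: "0 < L"
    and mean: "\<And>i. i \<in> \<Omega> \<Longrightarrow> measure_pmf.expectation (p i) (score i) = 0"
    and range: "\<And>i y. i \<in> \<Omega> \<Longrightarrow> y \<in> set_pmf (p i) \<Longrightarrow> score i y \<in> {a i..a i + L}"
  shows "measure_pmf.prob (Pi_pmf \<Omega> dflt p)
      {Y. bilinear_bound {..<m} {..<n} (\<lambda>i j. of_bool ((i, j) \<in> \<Omega>) * score (i, j) (Y (i, j))) (4.7 * L * sqrt m)}
      \<ge> 1 - exp (- real m)"
proof -
  define M where "M = Pi_pmf \<Omega> dflt p"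
  define Z where "Z Y i j = of_bool ((i, j) \<in> \<Omega>) * score (i, j) (Y (i, j))" for Y :: "nat \<times> nat \<Rightarrow> 'b" and i j
  \<comment> \<open>Half of the claimed norm bound, because passing to the grid loses a factor 2.
    The Hoeffding exponent is then \<open>2 * 2.35\<^sup>2 = 11.045\<close> times
    \<open>m\<close>.\<close>
  define t where "t = 2.35 * L * sqrt m"
  define N where "N k = {z \<in> grid k. L2_set (grid_point k z) {..<k} \<le> 1}" for k
  define E where "E zz = {Y. t < (\<Sum>i<m. \<Sum>j<n. grid_point m (fst zz) i * Z Y i j * grid_point n (snd zz) j)}" for zz
  define good where "good = {Y. bilinear_bound {..<m} {..<n} (Z Y) (4.7 * L * sqrt m)}"
  have m: "0 < m" using n by simp
  have fin: "finite \<Omega>"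
    using Om by (rule finite_subset) simp
  have t_nonneg: "0 \<le> t" using L by (simp add: t_def)
  have finN: "finite (N k)" for k
    unfolding N_def by (rule finite_subset[OF _ finite_grid]) auto
  have E_prob: "measure_pmf.prob M (E zz) \<le> exp (- 11 * real m)" if "zz \<in> N m \<times> N n" for zz
  proof -
    define c where "c ij = grid_point m (fst zz) (fst ij) * grid_point n (snd zz) (snd ij)" for ij
    have sum_eq: "(\<Sum>i<m. \<Sum>j<n. grid_point m (fst zz) i * Z Y i j * grid_point n (snd zz) j) =
        (\<Sum>ij\<in>\<Omega>. c ij * score ij (Y ij))" for Y
    proof -
      have "(\<Sum>i<m. \<Sum>j<n. grid_point m (fst zz) i * Z Y i j * grid_point n (snd zz) j) =
          (\<Sum>ij\<in>{..<m} \<times> {..<n}. of_bool (ij \<in> \<Omega>) * (c ij * score ij (Y ij)))"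
        unfolding sum.cartesian_product by (intro sum.cong refl) (auto simp: Z_def c_def)
      also have "\<dots> = (\<Sum>ij\<in>\<Omega>. of_bool (ij \<in> \<Omega>) * (c ij * score ij (Y ij)))"
        using Om by (intro sum.mono_neutral_right) auto
      finally show ?thesis by simp
    qed
    have "(\<Sum>ij\<in>\<Omega>. (c ij)\<^sup>2) \<le> (\<Sum>ij\<in>{..<m} \<times> {..<n}. (c ij)\<^sup>2)"
      using Om by (intro sum_mono2) auto
    also have "\<dots> = (\<Sum>i<m. (grid_point m (fst zz) i)\<^sup>2) * (\<Sum>j<n. (grid_point n (snd zz) j)\<^sup>2)"
      by (simp add: c_def power_mult_distrib sum_product sum.cartesian_product split_beta)
    also have "\<dots> = (L2_set (grid_point m (fst zz)) {..<m})\<^sup>2 * (L2_set (grid_point n (snd zz)) {..<n})\<^sup>2"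
      by (simp add: L2_set_def sum_nonneg)
    also have "\<dots> \<le> 1 * 1"
      using that by (intro mult_mono power_le_one) (auto simp: N_def)
    finally have "(\<Sum>ij\<in>\<Omega>. (c ij)\<^sup>2) \<le> 1" by simp
    then have "measure_pmf.prob M (E zz) \<le> exp (- 2 * t\<^sup>2 / L\<^sup>2)"
      unfolding M_def E_def sum_eq by (rule Hoeffding_Pi_pmf[OF fin L t_nonneg _ mean range])
    also have "- 2 * t\<^sup>2 / L\<^sup>2 = - 11.045 * real m"
      using L by (simp add: t_def power_mult_distrib power2_eq_square)
    also have "exp (- 11.045 * real m) \<le> exp (- 11 * real m)"
      by simp
    finally show ?thesis .
  qed
  have "UNIV - good \<subseteq> (\<Union>zz\<in>N m \<times> N n. E zz)"
  proof
    fix Y assume "Y \<in> UNIV - good"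
    moreover have "4.7 * L * sqrt m = 2 * t"
      by (simp add: t_def)
    ultimately have "\<not> bilinear_bound {..<m} {..<n} (Z Y) (2 * t)"
      by (simp add: good_def)
    then obtain z z' where "z \<in> grid m" "z' \<in> grid n" "L2_set (grid_point m z) {..<m} \<le> 1"
      "L2_set (grid_point n z') {..<n} \<le> 1"
      "\<not> (\<Sum>i<m. \<Sum>j<n. grid_point m z i * Z Y i j * grid_point n z' j) \<le> t"
      using bilinear_bound_of_grid[OF m n(1), of "Z Y" t] by blast
    then have "(z, z') \<in> N m \<times> N n" "Y \<in> E (z, z')"
      by (auto simp: N_def E_def)
    then show "Y \<in> (\<Union>zz\<in>N m \<times> N n. E zz)" by blast
  qed
  then have "measure_pmf.prob M (UNIV - good) \<le> measure_pmf.prob M (\<Union>zz\<in>N m \<times> N n. E zz)"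
    by (intro measure_pmf.finite_measure_mono) auto
  also have "\<dots> \<le> (\<Sum>zz\<in>N m \<times> N n. measure_pmf.prob M (E zz))"
    using finN by (intro measure_pmf.finite_measure_subadditive_finite) auto
  also have "\<dots> \<le> (\<Sum>zz\<in>N m \<times> N n. exp (- 11 * real m))"
    by (intro sum_mono E_prob)
  also have "\<dots> = real (card (N m)) * real (card (N n)) * exp (- 11 * real m)"
    by (simp add: card_cartesian_product)
  also have "\<dots> \<le> (1792 / 81) ^ m * (1792 / 81) ^ m * exp (- 11 * real m)"
  proof -
    have N_le: "real (card (N k)) \<le> (1792 / 81) ^ k" for k
      using card_mono[OF finite_grid, of "N k" k] card_grid_le[of k] by (force simp: N_def)
    have "(1792 / 81 :: real) ^ n \<le> (1792 / 81) ^ m"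
      using n by (intro power_increasing) auto
    then have "real (card (N n)) \<le> (1792 / 81) ^ m"
      using N_le[of n] by linarith
    then show ?thesis
      using N_le[of m] by (intro mult_right_mono mult_mono) auto
  qed
  also have "\<dots> = ((1792 / 81)\<^sup>2) ^ m * exp (- 11 * real m)"
    by (simp only: power2_eq_square power_mult_distrib)
  also have "\<dots> \<le> exp 10 ^ m * exp (- 11 * real m)"
  proof -
    \<comment> \<open>The square is about 489.4, well below 1024, and
      \<open>2 \<le> exp 1\<close>.\<close>
    have "(1792 / 81 :: real)\<^sup>2 \<le> 2 ^ 10" by (simp add: power2_eq_square)
    also have "(2 :: real) ^ 10 \<le> exp 1 ^ 10"
      using exp_ge_add_one_self[of 1] by (intro power_mono) auto
    also have "exp 1 ^ 10 = exp (10 :: real)"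
      by (simp flip: exp_of_nat_mult)
    finally show ?thesis
      by (intro mult_right_mono power_mono) auto
  qed
  also have "\<dots> = exp (- real m)"
    by (simp flip: exp_of_nat_mult exp_add)
  finally have "measure_pmf.prob M (UNIV - good) \<le> exp (- real m)" .
  then have "1 - exp (- real m) \<le> measure_pmf.prob M good"
    using measure_pmf.prob_compl[of good M] by simp
  then show ?thesis
    unfolding good_def M_def Z_def .
qed

section \<open>The likelihood\<close>

lemma second_order_lower_bound:
  fixes h h' h'' :: "real \<Rightarrow> real"
  assumes h: "\<And>t. t \<in> {a..b} \<Longrightarrow> (h has_real_derivative h' t) (at t)"
    and h': "\<And>t. t \<in> {a..b} \<Longrightarrow> (h' has_real_derivative h'' t) (at t)"
    and h'': "\<And>t. t \<in> {a..b} \<Longrightarrow> \<gamma> \<le> h'' t"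
    and x: "x \<in> {a..b}" and y: "y \<in> {a..b}"
  shows "h x + h' x * (y - x) + \<gamma> / 2 * (y - x)\<^sup>2 \<le> h y"
proof (cases "y = x")
  case False
  \<comment> \<open>The family of derivatives for Taylor's theorem with Lagrange remainder, which
    asks for two distinct points.\<close>
  define D where "D m = (if m = 0 then h else if m = 1 then h' else h'')" for m :: nat
  have "\<forall>m t. m < 2 \<and> a \<le> t \<and> t \<le> b \<longrightarrow> (D m has_real_derivative D (Suc m) t) (at t)"
    using h h' by (auto simp: D_def less_2_cases_iff)
  then obtain t where t: "if y < x then y < t \<and> t < x else x < t \<and> t < y"
    and eq: "h y = (\<Sum>m<2. D m x / fact m * (y - x) ^ m) + D 2 t / fact 2 * (y - x) ^ 2"
    using Taylor[of 2 D h a b x y] x y False by (auto simp: D_def)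
  have "t \<in> {a..b}"
    using t x y by (auto split: if_splits)
  then have "\<gamma> / 2 * (y - x)\<^sup>2 \<le> h'' t / 2 * (y - x)\<^sup>2"
    using h'' by (intro mult_right_mono) auto
  then show ?thesis
    using eq by (simp add: D_def numeral_2_eq_2)
qed simp

section \<open>Strong convexity of the negative log-likelihood and its score\<close>

locale link_function =
  fixes f :: "real \<Rightarrow> real" and \<alpha> \<gamma> L :: real
  assumes alpha_pos: "0 < \<alpha>" and gamma_pos: "0 < \<gamma>"
    and diff: "\<And>x. f differentiable (at x)" and diff': "\<And>x. deriv f differentiable (at x)"
    and range: "\<And>x. \<bar>x\<bar> \<le> \<alpha> \<Longrightarrow> 0 < f x \<and> f x < 1"
    and gamma: "gamma_bound f \<alpha> \<gamma>" and L: "L_bound f \<alpha> L"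
begin

lemma has_deriv: "(f has_real_derivative deriv f x) (at x)"
  using diff by (simp add: DERIV_deriv_iff_real_differentiable)

lemma has_deriv': "(deriv f has_real_derivative deriv (deriv f) x) (at x)"
  using diff' by (simp add: DERIV_deriv_iff_real_differentiable)

lemma gamma_le:
  assumes "\<bar>x\<bar> \<le> \<alpha>"
  shows "\<gamma> \<le> (deriv f x)\<^sup>2 / (f x)\<^sup>2 - deriv (deriv f) x / f x"
    and "\<gamma> \<le> (deriv f x)\<^sup>2 / (1 - f x)\<^sup>2 + deriv (deriv f) x / (1 - f x)"
  using gamma assms unfolding gamma_bound_def by (simp_all add: le_INF_iff)

lemma L_ge:
  assumes "\<bar>x\<bar> \<le> \<alpha>"
  shows "\<bar>deriv f x\<bar> / (f x * (1 - f x)) \<le> L"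
  using L assms unfolding L_bound_def by (simp add: SUP_le_iff)

text \<open>Otherwise \<open>deriv f\<close> vanishes on the whole interval, so the second
  derivative vanishes at 0, and the first expression in \<open>gamma_bound\<close> is 0 there,
  against \<open>0 < \<gamma>\<close>. Hoeffding's inequality is applied with this
  \<open>L\<close>.\<close>

lemma L_pos: "0 < L"
proof (rule ccontr)
  assume "\<not> 0 < L"
  have zero: "deriv f x = 0" if "\<bar>x\<bar> \<le> \<alpha>" for x
  proof -
    have "\<bar>deriv f x\<bar> / (f x * (1 - f x)) \<le> 0"
      using L_ge[OF that] \<open>\<not> 0 < L\<close> by linarith
    moreover have "0 < f x * (1 - f x)"
      using range[OF that] by simp
    ultimately show ?thesis
      by (simp add: divide_le_0_iff)
  qed
  have "(deriv f has_real_derivative 0) (at 0)"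
  proof (rule has_field_derivative_transform_within[where d = \<alpha>])
    show "((\<lambda>_. 0) has_real_derivative 0) (at 0)" by simp
  qed (use alpha_pos zero in \<open>auto simp: dist_real_def\<close>)
  then have "deriv (deriv f) 0 = 0"
    by (rule DERIV_imp_deriv)
  then show False
    using gamma_le(1)[of 0] gamma_pos alpha_pos zero[of 0] by simp
qed

text \<open>The two expressions in \<open>gamma_bound\<close> are the second derivatives of
  \<open>- ln f\<close> and \<open>- ln (1 - f)\<close>, so \<open>\<gamma>\<close> is a modulus of
  strong convexity for both kinds of observation.\<close>

lemma neg_ln_lower_bound:
  assumes x: "\<bar>x\<bar> \<le> \<alpha>" and y: "\<bar>y\<bar> \<le> \<alpha>"
  shows "- ln (f x) + - (deriv f x / f x) * (y - x) + \<gamma> / 2 * (y - x)\<^sup>2 \<le> - ln (f y)"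
proof (rule second_order_lower_bound[where a = "- \<alpha>" and b = \<alpha> and
      h'' = "\<lambda>t. (deriv f t)\<^sup>2 / (f t)\<^sup>2 - deriv (deriv f) t / f t"])
  fix t assume "t \<in> {- \<alpha>..\<alpha>}"
  then have t: "\<bar>t\<bar> \<le> \<alpha>" by auto
  note ft = range[OF t]
  show "((\<lambda>t. - ln (f t)) has_real_derivative - (deriv f t / f t)) (at t)"
    using ft by (auto intro!: derivative_eq_intros has_deriv)
  show "((\<lambda>t. - (deriv f t / f t)) has_real_derivative
      (deriv f t)\<^sup>2 / (f t)\<^sup>2 - deriv (deriv f) t / f t) (at t)"
    using ft by (auto intro!: derivative_eq_intros has_deriv has_deriv' simp: field_simps power2_eq_square)
  show "\<gamma> \<le> (deriv f t)\<^sup>2 / (f t)\<^sup>2 - deriv (deriv f) t / f t"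
    by (rule gamma_le(1)[OF t])
qed (use x y in auto)

lemma neg_ln_compl_lower_bound:
  assumes x: "\<bar>x\<bar> \<le> \<alpha>" and y: "\<bar>y\<bar> \<le> \<alpha>"
  shows "- ln (1 - f x) + deriv f x / (1 - f x) * (y - x) + \<gamma> / 2 * (y - x)\<^sup>2 \<le> - ln (1 - f y)"
proof (rule second_order_lower_bound[where a = "- \<alpha>" and b = \<alpha> and
      h'' = "\<lambda>t. (deriv f t)\<^sup>2 / (1 - f t)\<^sup>2 + deriv (deriv f) t / (1 - f t)"])
  fix t assume "t \<in> {- \<alpha>..\<alpha>}"
  then have t: "\<bar>t\<bar> \<le> \<alpha>" by auto
  note ft = range[OF t]
  show "((\<lambda>t. - ln (1 - f t)) has_real_derivative deriv f t / (1 - f t)) (at t)"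
    using ft by (auto intro!: derivative_eq_intros has_deriv)
  show "((\<lambda>t. deriv f t / (1 - f t)) has_real_derivative
      (deriv f t)\<^sup>2 / (1 - f t)\<^sup>2 + deriv (deriv f) t / (1 - f t)) (at t)"
  proof -
    have "((\<lambda>t. deriv f t / (1 - f t)) has_real_derivative
        (deriv (deriv f) t * (1 - f t) - deriv f t * (0 - deriv f t)) / ((1 - f t) * (1 - f t))) (at t)"
      using ft by (intro DERIV_divide DERIV_diff DERIV_const has_deriv has_deriv') auto
    moreover have "(q * c - p * (0 - p)) / (c * c) = p\<^sup>2 / c\<^sup>2 + q / c" if "c \<noteq> 0" for c p q :: real
      using that by (simp add: field_simps power2_eq_square)
    ultimately show ?thesis
      using ft by simp
  qed
  show "\<gamma> \<le> (deriv f t)\<^sup>2 / (1 - f t)\<^sup>2 + deriv (deriv f) t / (1 - f t)"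
    by (rule gamma_le(2)[OF t])
qed (use x y in auto)

text \<open>The derivative of one summand of the negative log-likelihood with respect to its entry.
  On the support of the observations the second branch means \<open>y = - 1\<close>.\<close>

definition score :: "real mat \<Rightarrow> nat \<times> nat \<Rightarrow> int \<Rightarrow> real" where
  "score M ij y = (if y = 1 then - (deriv f (M $$ ij) / f (M $$ ij))
     else deriv f (M $$ ij) / (1 - f (M $$ ij)))"

lemma neg_log_likelihood_lower_bound:
  assumes "finite \<Omega>" and Y: "\<And>ij. ij \<in> \<Omega> \<Longrightarrow> Y ij = 1 \<or> Y ij = - 1"
    and M: "\<And>ij. ij \<in> \<Omega> \<Longrightarrow> \<bar>M $$ ij\<bar> \<le> \<alpha>" and M': "\<And>ij. ij \<in> \<Omega> \<Longrightarrow> \<bar>M' $$ ij\<bar> \<le> \<alpha>"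
  shows "neg_log_likelihood f \<Omega> Y M + (\<Sum>ij\<in>\<Omega>. score M ij (Y ij) * (M' $$ ij - M $$ ij))
      + \<gamma> / 2 * (\<Sum>ij\<in>\<Omega>. (M' $$ ij - M $$ ij)\<^sup>2) \<le> neg_log_likelihood f \<Omega> Y M'"
proof -
  let ?l = "\<lambda>M ij. of_bool (Y ij = 1) * ln (f (M $$ ij)) + of_bool (Y ij = - 1) * ln (1 - f (M $$ ij))"
  have "(\<Sum>ij\<in>\<Omega>. - ?l M ij + score M ij (Y ij) * (M' $$ ij - M $$ ij) + \<gamma> / 2 * (M' $$ ij - M $$ ij)\<^sup>2)
      \<le> (\<Sum>ij\<in>\<Omega>. - ?l M' ij)"
  proof (rule sum_mono)
    fix ij assume ij: "ij \<in> \<Omega>"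
    show "- ?l M ij + score M ij (Y ij) * (M' $$ ij - M $$ ij) + \<gamma> / 2 * (M' $$ ij - M $$ ij)\<^sup>2
        \<le> - ?l M' ij"
      using Y[OF ij] neg_ln_lower_bound[OF M M', OF ij ij] neg_ln_compl_lower_bound[OF M M', OF ij ij]
      by (auto simp: score_def)
  qed
  then show ?thesis
    by (simp add: neg_log_likelihood_def sum.distrib sum_subtractf sum_negf sum_distrib_left)
qed

text \<open>The two values \<open>- q / p\<close> and \<open>q / (1 - p)\<close> differ by
  \<open>q / (p * (1 - p))\<close>, which \<open>L\<close> bounds in absolute value. The sign of
  \<open>q\<close> decides which value is the smaller one, hence the minimum.\<close>

lemma score_range:
  assumes "\<bar>M $$ ij\<bar> \<le> \<alpha>"
  shows "score M ij y \<in> {min (score M ij 1) (score M ij (- 1))..min (score M ij 1) (score M ij (- 1)) + L}"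
proof -
  define p where "p = f (M $$ ij)"
  define q where "q = deriv f (M $$ ij)"
  have p: "0 < p" "p < 1"
    using range[OF assms] by (auto simp: p_def)
  have eq: "q / (1 - p) + q / p = q / (p * (1 - p))"
    using p by (simp add: field_simps)
  have "\<bar>q / (1 - p) + q / p\<bar> \<le> L"
    using L_ge[OF assms] p unfolding eq by (simp add: p_def q_def abs_mult)
  then show ?thesis
    by (auto simp: score_def min_def p_def q_def abs_le_iff)
qed

text \<open>With \<open>p = f (M $$ ij)\<close> and \<open>q\<close> the derivative there, the mean
  is \<open>p * (- q / p) + (1 - p) * (q / (1 - p))\<close>.\<close>

lemma score_mean:
  assumes "\<bar>M $$ ij\<bar> \<le> \<alpha>"
  shows "measure_pmf.expectation (map_pmf (\<lambda>b. if b then 1 else - 1) (bernoulli_pmf (f (M $$ ij)))) (score M ij) = 0"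
  using range[OF assms] by (simp add: score_def)

lemma prob_score_bilinear_bound:
  assumes "0 < n" "n \<le> m" "\<Omega> \<subseteq> {..<m} \<times> {..<n}"
    and M: "\<And>ij. ij \<in> \<Omega> \<Longrightarrow> \<bar>M $$ ij\<bar> \<le> \<alpha>"
  shows "measure_pmf.prob (one_bit_observations f \<Omega> M)
      {Y. bilinear_bound {..<m} {..<n} (\<lambda>i j. of_bool ((i, j) \<in> \<Omega>) * score M (i, j) (Y (i, j))) (4.7 * L * sqrt m)}
      \<ge> 1 - exp (- real m)"
  unfolding one_bit_observations_def
  using assms by (intro prob_bilinear_bound[where a = "\<lambda>ij. min (score M ij 1) (score M ij (- 1))"]
      L_pos score_mean score_range) auto

end

lemma one_bit_observations_support:
  assumes "finite \<Omega>" "Y \<in> set_pmf (one_bit_observations f \<Omega> M)" "ij \<in> \<Omega>"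
  shows "Y ij = 1 \<or> Y ij = - 1"
proof -
  have "Y \<in> PiE_dflt \<Omega> 0 (set_pmf \<circ> (\<lambda>ij. map_pmf (\<lambda>b. if b then 1 else - 1) (bernoulli_pmf (f (M $$ ij)))))"
    using assms(2) unfolding one_bit_observations_def
    by (rule subsetD[OF set_Pi_pmf_subset'[OF assms(1)], rotated])
  then show ?thesis
    using assms(3) unfolding PiE_dflt_def by fastforce
qed

section \<open>Regular bipartite graphs\<close>

text \<open>The entrywise square expands into products indexed by pairs in
  \<open>{..<p} \<times> {..<p}\<close>, which \<open>g\<close> enumerates; this is the rank bound
  for a Hadamard square.\<close>

lemma rank_one_sum_square:
  fixes a :: "nat \<Rightarrow> 'a \<Rightarrow> real" and b :: "nat \<Rightarrow> 'b \<Rightarrow> real"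
  shows "\<exists>a' b'. \<forall>i j. (\<Sum>l<p. a l i * b l j)\<^sup>2 = (\<Sum>l<p * p. a' l i * b' l j)"
proof -
  obtain g where g: "bij_betw g {0..<card ({..<p} \<times> {..<p})} ({..<p} \<times> {..<p})"
    using ex_bij_betw_nat_finite[of "{..<p} \<times> {..<p}"] by auto
  then have g: "bij_betw g {..<p * p} ({..<p} \<times> {..<p})"
    by (simp add: card_cartesian_product lessThan_atLeast0)
  define a' where "a' l i = a (fst (g l)) i * a (snd (g l)) i" for l i
  define b' where "b' l j = b (fst (g l)) j * b (snd (g l)) j" for l j
  have "(\<Sum>l<p. a l i * b l j)\<^sup>2 = (\<Sum>l<p * p. a' l i * b' l j)" for i j
  proof -
    have "(\<Sum>l<p. a l i * b l j)\<^sup>2 =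
        (\<Sum>kl\<in>{..<p} \<times> {..<p}. (a (fst kl) i * a (snd kl) i) * (b (fst kl) j * b (snd kl) j))"
      unfolding power2_eq_square sum_product sum.cartesian_product
      by (intro sum.cong refl) (auto simp: mult_ac)
    then show ?thesis
      using sum.reindex_bij_betw[OF g, of "\<lambda>kl. (a (fst kl) i * a (snd kl) i) * (b (fst kl) j * b (snd kl) j)"]
      by (simp add: a'_def b'_def)
  qed
  then show ?thesis by (intro exI allI)
qed

lemma rank_one_sum_diff:
  fixes a a' :: "nat \<Rightarrow> 'a \<Rightarrow> real" and b b' :: "nat \<Rightarrow> 'b \<Rightarrow> real"
  shows "\<exists>c d. \<forall>i j. (\<Sum>l<p. a l i * b l j) - (\<Sum>l<p. a' l i * b' l j) = (\<Sum>l<2 * p. c l i * d l j)"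
proof -
  define c where "c l i = (if l < p then a l i else - a' (l - p) i)" for l i
  define d where "d l j = (if l < p then b l j else b' (l - p) j)" for l j
  have "(\<Sum>l<2 * p. c l i * d l j) = (\<Sum>l<p. a l i * b l j) - (\<Sum>l<p. a' l i * b' l j)" for i j
  proof -
    have "(\<Sum>l<2 * p. c l i * d l j) = (\<Sum>l\<in>{0..<p}. c l i * d l j) + (\<Sum>l\<in>{p..<p + p}. c l i * d l j)"
      by (simp add: lessThan_atLeast0 mult_2 sum.atLeastLessThan_concat)
    also have "(\<Sum>l\<in>{p..<p + p}. c l i * d l j) = (\<Sum>l\<in>{0..<p}. c (l + p) i * d (l + p) j)"
      using sum.shift_bounds_nat_ivl[of "\<lambda>l. c l i * d l j" 0 p p] by simp
    finally show ?thesis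
      by (simp add: c_def d_def sum_negf lessThan_atLeast0)
  qed
  then show ?thesis by (intro exI allI) (rule sym)
qed

lemma bilinear_bound_uminus:
  assumes "bilinear_bound I J A s"
  shows "bilinear_bound I J (\<lambda>i j. - A i j) s"
  unfolding bilinear_bound_def
proof (intro allI)
  fix x y
  have "(\<Sum>i\<in>I. \<Sum>j\<in>J. - x i * A i j * y j) \<le> s * L2_set (\<lambda>i. - x i) I * L2_set y J"
    using assms[unfolded bilinear_bound_def, THEN spec[of _ "\<lambda>i. - x i"], THEN spec[of _ y]] .
  then show "(\<Sum>i\<in>I. \<Sum>j\<in>J. x i * - A i j * y j) \<le> s * L2_set x I * L2_set y J"
    by (simp add: L2_set_def)
qed

text \<open>The graph acts on \<open>D \<circ> D\<close>, whose rank is at most the square of that of \<open>D\<close>: its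
  top singular part is a multiple of \<open>\<parallel>D\<parallel>\<^sub>F\<^sup>2\<close>, the rest is controlled by the second singular value.\<close>

lemma sampled_norm_lower_bound:
  fixes D G :: "nat \<Rightarrow> nat \<Rightarrow> real" and p :: nat
  assumes G: "bilinear_bound {..<m} {..<n} (\<lambda>i j. G i j - \<tau>) s" and "0 \<le> s"
    and D: "\<And>i j. i < m \<Longrightarrow> j < n \<Longrightarrow> D i j = (\<Sum>l<p. a l i * b l j)"
    and bound: "\<And>i j. i < m \<Longrightarrow> j < n \<Longrightarrow> \<bar>D i j\<bar> \<le> \<beta>" and "0 \<le> \<beta>"
  shows "\<tau> * (\<Sum>i<m. \<Sum>j<n. (D i j)\<^sup>2) \<le> (\<Sum>i<m. \<Sum>j<n. G i j * (D i j)\<^sup>2)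
      + s * p * \<beta> * sqrt (\<Sum>i<m. \<Sum>j<n. (D i j)\<^sup>2)"
proof -
  obtain a' b' :: "nat \<Rightarrow> nat \<Rightarrow> real"
    where ab: "\<forall>i j. (\<Sum>l<p. a l i * b l j)\<^sup>2 = (\<Sum>l<p * p. a' l i * b' l j)"
    using rank_one_sum_square[where p = p and a = a and b = b] by (elim exE)
  have main: "(\<Sum>i<m. \<Sum>j<n. - (G i j - \<tau>) * (D i j)\<^sup>2) \<le>
      s * sqrt (real (p * p)) * sqrt (\<Sum>i<m. \<Sum>j<n. ((D i j)\<^sup>2)\<^sup>2)"
    using bilinear_bound_uminus[OF G] \<open>0 \<le> s\<close>
    by (rule inner_product_le_of_bilinear_bound[OF finite_lessThan, where a = a' and b = b'])
      (simp add: D ab)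
  \<comment> \<open>The entry bound turns the Frobenius norm of the entrywise square into
    \<open>\<beta>\<close> times that of \<open>D\<close>, and \<open>sqrt (p * p)\<close> is
    \<open>p\<close>.\<close>
  have "sqrt (\<Sum>i<m. \<Sum>j<n. ((D i j)\<^sup>2)\<^sup>2) \<le> sqrt (\<beta>\<^sup>2 * (\<Sum>i<m. \<Sum>j<n. (D i j)\<^sup>2))"
  proof -
    have "((D i j)\<^sup>2)\<^sup>2 \<le> \<beta>\<^sup>2 * (D i j)\<^sup>2" if "i < m" "j < n" for i j
    proof -
      have "(D i j)\<^sup>2 \<le> \<beta>\<^sup>2"
        using power_mono[OF bound[OF that] abs_ge_zero, of 2] by simp
      then show ?thesis
        unfolding power2_eq_square[of "(D i j)\<^sup>2"] by (rule mult_right_mono) simp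
    qed
    then show ?thesis
      unfolding sum_distrib_left by (intro real_sqrt_le_mono sum_mono) simp
  qed
  then have "s * sqrt (real (p * p)) * sqrt (\<Sum>i<m. \<Sum>j<n. ((D i j)\<^sup>2)\<^sup>2) \<le>
      s * p * (\<beta> * sqrt (\<Sum>i<m. \<Sum>j<n. (D i j)\<^sup>2))"
    using \<open>0 \<le> s\<close> \<open>0 \<le> \<beta>\<close> by (intro mult_mono) (simp_all add: real_sqrt_mult sum_nonneg)
  with main have "(\<Sum>i<m. \<Sum>j<n. - (G i j - \<tau>) * (D i j)\<^sup>2) \<le>
      s * p * (\<beta> * sqrt (\<Sum>i<m. \<Sum>j<n. (D i j)\<^sup>2))"
    by (rule order_trans)
  moreover have "(\<Sum>i<m. \<Sum>j<n. - (G i j - \<tau>) * (D i j)\<^sup>2) =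
      \<tau> * (\<Sum>i<m. \<Sum>j<n. (D i j)\<^sup>2) - (\<Sum>i<m. \<Sum>j<n. G i j * (D i j)\<^sup>2)"
    by (simp add: left_diff_distrib sum_subtractf sum_distrib_left)
  ultimately show ?thesis
    by simp
qed

lemma constraint_set_entry_le:
  assumes "M \<in> constraint_set m n \<alpha> r" "i < m" "j < n"
  shows "\<bar>M $$ (i, j)\<bar> \<le> \<alpha>"
proof -
  have M: "M \<in> carrier_mat m n" "entry_norm M \<le> \<alpha>"
    using assms(1) by (auto simp: constraint_set_def)
  have "\<bar>M $$ (i, j)\<bar> \<in> abs ` elements_mat M"
    using elements_matI[OF M(1) assms(2,3) refl] by blast
  then have "\<bar>M $$ (i, j)\<bar> \<le> entry_norm M"
    unfolding entry_norm_def by (intro Max_ge) (simp_all add: elements_mat_def)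
  then show ?thesis using M by simp
qed

text \<open>The weights are balanced: \<open>1 / sqrt 2 + 1 / (2 + sqrt 2) = 1\<close>.\<close>

lemma sum_le_max_sqrt2:
  fixes a b :: real
  assumes "0 \<le> a" "0 \<le> b" "sqrt 2 * a \<le> M" "(2 + sqrt 2) * b \<le> M"
  shows "a + b \<le> M"
proof -
  have s: "sqrt 2 * sqrt 2 = (2 :: real)" "1 < sqrt (2 :: real)" by auto
  have s2: "sqrt 2 < (2 :: real)"
    using real_sqrt_less_mono[of 2 4] by simp
  have "2 * a \<le> sqrt 2 * M"
    using mult_left_mono[OF assms(3), of "sqrt 2"] s by (simp flip: mult.assoc)
  moreover have "(2 - sqrt 2) * (2 + sqrt 2) = (2 :: real)"
    by (simp add: algebra_simps)
  then have "2 * b \<le> (2 - sqrt 2) * M"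
    using mult_left_mono[OF assms(4), of "2 - sqrt 2"] s2 by (simp flip: mult.assoc)
  ultimately show ?thesis by (simp add: algebra_simps)
qed

section \<open>The spectrum of a row-regular bipartite graph\<close>

locale regular_graph =
  fixes m n d :: nat and \<Omega> :: "(nat \<times> nat) set" and G :: "real mat"
  assumes n: "1 \<le> n" "n \<le> m" and d: "1 \<le> d"
    and Om: "\<Omega> \<subseteq> {..<m} \<times> {..<n}" and G_def: "G = biadjacency m n \<Omega>"
    and reg: "row_regular m n \<Omega> d" and A1: "assumption_A1 G"
begin

lemma finite_edges: "finite \<Omega>"
  using Om by (rule finite_subset) simp

lemma G_carrier: "G \<in> carrier_mat m n"
  by (simp add: G_def biadjacency_def)

lemma G_index: "i < m \<Longrightarrow> j < n \<Longrightarrow> G $$ (i, j) = of_bool ((i, j) \<in> \<Omega>)"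
  by (simp add: G_def biadjacency_def)

lemma row_sum: "i < m \<Longrightarrow> (\<Sum>j<n. G $$ (i, j)) = d"
proof -
  assume i: "i < m"
  have "(\<Sum>j<n. G $$ (i, j)) = (\<Sum>j<n. of_bool ((i, j) \<in> \<Omega>))"
    using i by (intro sum.cong) (auto simp: G_index)
  also have "\<dots> = card ({..<n} \<inter> {j. (i, j) \<in> \<Omega>})"
    by simp
  also have "{..<n} \<inter> {j. (i, j) \<in> \<Omega>} = {j. j < n \<and> (i, j) \<in> \<Omega>}"
    by auto
  finally show ?thesis
    using reg i by (simp add: row_regular_def)
qed

lemma d_le: "d \<le> n"
proof -
  have "d = card {j. j < n \<and> (0, j) \<in> \<Omega>}"
    using reg n by (simp add: row_regular_def)
  also have "\<dots> \<le> card {..<n}"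
    by (intro card_mono) auto
  finally show ?thesis by simp
qed

lemma card_edges: "card \<Omega> = m * d"
proof -
  have "\<Omega> = (SIGMA i:{..<m}. {j. j < n \<and> (i, j) \<in> \<Omega>})"
    using Om by auto
  moreover have "card (SIGMA i:{..<m}. {j. j < n \<and> (i, j) \<in> \<Omega>}) = (\<Sum>i<m. card {j. j < n \<and> (i, j) \<in> \<Omega>})"
    by (rule card_SigmaI) simp_all
  ultimately have "card \<Omega> = (\<Sum>i<m. card {j. j < n \<and> (i, j) \<in> \<Omega>})"
    by (rule arg_cong[where f = card, THEN trans])
  then show ?thesis
    using reg by (simp add: row_regular_def)
qed

lemma sum_edges:
  "(\<Sum>ij\<in>\<Omega>. g ij) = (\<Sum>i<m. \<Sum>j<n. of_bool ((i, j) \<in> \<Omega>) * (g (i, j) :: real))"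
proof -
  have "(\<Sum>i<m. \<Sum>j<n. of_bool ((i, j) \<in> \<Omega>) * g (i, j)) = (\<Sum>ij\<in>{..<m} \<times> {..<n}. of_bool (ij \<in> \<Omega>) * g ij)"
    unfolding sum.cartesian_product by (intro sum.cong) auto
  also have "\<dots> = (\<Sum>ij\<in>\<Omega>. of_bool (ij \<in> \<Omega>) * g ij)"
    using Om by (intro sum.mono_neutral_right) auto
  finally show ?thesis by simp
qed

abbreviation "\<sigma>1 \<equiv> singular_value G 1"
abbreviation "\<sigma>2 \<equiv> singular_value G 2"

lemma right_vector: "i < m \<Longrightarrow> (\<Sum>j<n. G $$ (i, j) * (1 / sqrt n)) = \<sigma>1 * (1 / sqrt m)"
proof -
  assume i: "i < m"
  have eq: "G *\<^sub>v ((1 / sqrt n) \<cdot>\<^sub>v ones_vec n) = \<sigma>1 \<cdot>\<^sub>v ((1 / sqrt m) \<cdot>\<^sub>v ones_vec m)"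
    using A1 G_carrier unfolding assumption_A1_def singular_vectors_def by auto
  show ?thesis
    using arg_cong[OF eq, of "\<lambda>v. vec_index v i"] i G_carrier
    by (simp add: ones_vec_def scalar_prod_def lessThan_atLeast0)
qed

lemma left_vector: "j < n \<Longrightarrow> (\<Sum>i<m. G $$ (i, j) * (1 / sqrt m)) = \<sigma>1 * (1 / sqrt n)"
proof -
  assume j: "j < n"
  have eq: "G\<^sup>T *\<^sub>v ((1 / sqrt m) \<cdot>\<^sub>v ones_vec m) = \<sigma>1 \<cdot>\<^sub>v ((1 / sqrt n) \<cdot>\<^sub>v ones_vec n)"
    using A1 G_carrier unfolding assumption_A1_def singular_vectors_def by auto
  show ?thesis
    using arg_cong[OF eq, of "\<lambda>v. vec_index v j"] j G_carrier
    by (simp add: ones_vec_def scalar_prod_def lessThan_atLeast0)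
qed

lemma sigma1: "\<sigma>1 = d * sqrt m / sqrt n"
proof -
  have "d * (1 / sqrt n) = \<sigma>1 * (1 / sqrt m)"
    using right_vector[of 0] row_sum[of 0] n by (simp flip: sum_divide_distrib)
  then show ?thesis
    using n by (simp add: field_simps)
qed

lemma sigma1_pos: "0 < \<sigma>1"
  unfolding sigma1 using n d by simp

text \<open>Both top singular vectors are constant, so the top singular part of \<open>G\<close> is
  the constant matrix with entries \<open>\<sigma>1 / sqrt (m * n)\<close>.\<close>

lemma bilinear_bound_graph:
  "bilinear_bound {..<m} {..<n} (\<lambda>i j. G $$ (i, j) - \<sigma>1 / sqrt (m * n)) \<sigma>2"
proof -
  have "bilinear_bound {..<m} {..<n} (\<lambda>i j. G $$ (i, j) - \<sigma>1 * (1 / sqrt m) * (1 / sqrt n)) \<sigma>2"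
  proof (rule bilinear_bound_second_singular_value[OF G_carrier _ refl sigma1_pos])
    show "0 < n" using n by simp
    show "(\<Sum>i<m. 1 / sqrt m * (1 / sqrt m)) = 1" "(\<Sum>j<n. 1 / sqrt n * (1 / sqrt n)) = 1"
      using n by simp_all
    show "(\<Sum>j<n. G $$ (i, j) * (1 / sqrt n)) = \<sigma>1 * (1 / sqrt m)" if "i < m" for i
      using that by (rule right_vector)
    show "(\<Sum>i<m. G $$ (i, j) * (1 / sqrt m)) = \<sigma>1 * (1 / sqrt n)" if "j < n" for j
      using that by (rule left_vector)
  qed
  then show ?thesis
    by (simp add: real_sqrt_mult)
qed

end

section \<open>The error bound\<close>

context regular_graph
begin

lemma error_le:
  fixes D Z :: "nat \<Rightarrow> nat \<Rightarrow> real" and r :: nat and \<alpha> \<gamma> s :: real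
  assumes D: "\<And>i j. i < m \<Longrightarrow> j < n \<Longrightarrow> D i j = (\<Sum>l<2 * r. a l i * b l j)"
    and bound: "\<And>i j. i < m \<Longrightarrow> j < n \<Longrightarrow> \<bar>D i j\<bar> \<le> 2 * \<alpha>" and "0 \<le> \<alpha>" "0 < \<gamma>" "0 \<le> s"
    and Z: "bilinear_bound {..<m} {..<n} Z s"
    and curv: "\<gamma> / 2 * (\<Sum>i<m. \<Sum>j<n. G $$ (i, j) * (D i j)\<^sup>2) \<le> - (\<Sum>i<m. \<Sum>j<n. Z i j * D i j)"
  shows "sqrt (\<Sum>i<m. \<Sum>j<n. (D i j)\<^sup>2) / sqrt (m * n)
    \<le> 4 * real r * \<alpha> * \<sigma>2 / \<sigma>1 + 2 / \<gamma> * s * sqrt (real (2 * r)) / \<sigma>1"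
proof -
  define N where "N = sqrt (\<Sum>i<m. \<Sum>j<n. (D i j)\<^sup>2)"
  define P where "P = (\<Sum>i<m. \<Sum>j<n. G $$ (i, j) * (D i j)\<^sup>2)"
  define K where "K = 4 * real r * \<alpha> * \<sigma>2 + 2 / \<gamma> * s * sqrt (real (2 * r))"
  have N_nonneg: "0 \<le> N" by (simp add: N_def sum_nonneg)
  have N2: "N\<^sup>2 = (\<Sum>i<m. \<Sum>j<n. (D i j)\<^sup>2)"
    by (simp add: N_def sum_nonneg)
  have K_nonneg: "0 \<le> K"
    using assms(3-5) singular_value_nonneg[of G 2] by (simp add: K_def)
  have "\<gamma> / 2 * P \<le> (\<Sum>i<m. \<Sum>j<n. - Z i j * D i j)"
    using curv by (simp add: P_def sum_negf)
  also have "\<dots> \<le> s * sqrt (real (2 * r)) * N"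
    unfolding N_def using bilinear_bound_uminus[OF Z] \<open>0 \<le> s\<close>
    by (rule inner_product_le_of_bilinear_bound[OF finite_lessThan, where a = a and b = b]) (simp add: D)
  finally have "P \<le> 2 / \<gamma> * s * sqrt (real (2 * r)) * N"
    using \<open>0 < \<gamma>\<close> by (simp add: field_simps)
  \<comment> \<open>The difference is a sum of \<open>2 * r\<close> rank-one terms with entries at
    most \<open>2 * \<alpha>\<close>, whence the coefficient \<open>4 * r * \<alpha>\<close> in
    \<open>K\<close>.\<close>
  moreover have "\<sigma>1 / sqrt (m * n) * (\<Sum>i<m. \<Sum>j<n. (D i j)\<^sup>2) \<le> P + \<sigma>2 * real (2 * r) * (2 * \<alpha>) * N"
    unfolding P_def N_def using bilinear_bound_graph singular_value_nonneg
    by (rule sampled_norm_lower_bound[where a = a and b = b]) (use D bound \<open>0 \<le> \<alpha>\<close> in simp_all)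
  ultimately have main: "\<sigma>1 / sqrt (m * n) * N\<^sup>2 \<le> K * N"
    by (simp add: K_def N2 algebra_simps)
  have "\<sigma>1 / sqrt (m * n) * N \<le> K"
  proof (cases "N = 0")
    case True
    then show ?thesis using K_nonneg by simp
  next
    case False
    then have "0 < N" using N_nonneg by simp
    moreover have "\<sigma>1 / sqrt (m * n) * N * N \<le> K * N"
      using main unfolding power2_eq_square mult.assoc .
    ultimately show ?thesis
      by (rule mult_right_le_imp_le[rotated])
  qed
  then have "\<sigma>1 * (N / sqrt (m * n)) \<le> K"
    by simp
  then have "N / sqrt (m * n) \<le> K / \<sigma>1"
    using sigma1_pos by (simp add: pos_le_divide_eq mult.commute)
  then show ?thesis
    by (simp add: K_def N_def add_divide_distrib)
qed

text \<open>Brings the noise term into the shape stated in the theorem. After inserting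
  \<open>\<sigma>1 = d * sqrt m / sqrt n\<close>, the claim for positive \<open>r\<close> is
  \<open>d \<le> r * n\<close>, which follows from \<open>d \<le> n\<close>.\<close>

lemma sampling_term_le:
  fixes r :: nat
  shows "sqrt m * sqrt r / \<sigma>1 \<le> m * sqrt (real r ^ 3 * n) / \<sigma>1\<^sup>2"
proof -
  have "sqrt r * d \<le> sqrt r * (r * n)"
  proof (cases "r = 0")
    case False
    then have "n \<le> r * n" by simp
    then have "real d \<le> real (r * n)"
      using d_le by linarith
    then show ?thesis by (intro mult_left_mono) simp_all
  qed simp
  then have "sqrt r * d / sqrt n \<le> sqrt r * (r * n) / sqrt n"
    by (rule divide_right_mono) simp
  also have "\<dots> = sqrt r * r * (n / sqrt n)"
    by simp
  also have "\<dots> = sqrt (real r ^ 3 * n)"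
    by (simp add: real_sqrt_mult power3_eq_cube real_div_sqrt)
  finally have "m * (sqrt r * d / sqrt n) \<le> m * sqrt (real r ^ 3 * n)"
    by (rule mult_left_mono) simp
  moreover have "m * (sqrt r * d / sqrt n) = sqrt m * sqrt r * \<sigma>1"
  proof -
    have "sqrt m * sqrt r * (d * sqrt m / sqrt n) = (sqrt m * sqrt m) * (sqrt r * d / sqrt n)"
      by (simp add: mult_ac)
    then show ?thesis
      unfolding sigma1 by simp
  qed
  ultimately have "sqrt m * sqrt r * \<sigma>1 / \<sigma>1\<^sup>2 \<le> m * sqrt (real r ^ 3 * n) / \<sigma>1\<^sup>2"
    by (intro divide_right_mono) simp_all
  then show ?thesis
    using sigma1_pos by (simp add: power2_eq_square)
qed

lemma max_bound:
  fixes r :: nat and \<alpha> \<gamma> L x :: real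
  assumes "0 \<le> \<alpha>" "0 < \<gamma>" "0 < L"
    and x: "x \<le> 4 * real r * \<alpha> * \<sigma>2 / \<sigma>1 + 2 / \<gamma> * (4.7 * L * sqrt m) * sqrt (real (2 * r)) / \<sigma>1"
  shows "x \<le> max (4 * sqrt 2 * \<alpha> * r * \<sigma>2 / \<sigma>1)
    (32.16 * sqrt 2 * L / \<gamma> * m * sqrt (real r ^ 3 * n) / \<sigma>1\<^sup>2)"
    (is "_ \<le> max ?A ?B")
proof (rule order_trans[OF x sum_le_max_sqrt2])
  define c where "c = sqrt 2 * L / \<gamma> * (sqrt m * sqrt r / \<sigma>1)"
  have c_nonneg: "0 \<le> c"
    using assms sigma1_pos by (simp add: c_def)
  have b: "2 / \<gamma> * (4.7 * L * sqrt m) * sqrt (real (2 * r)) / \<sigma>1 = 9.4 * c"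
    by (simp add: c_def real_sqrt_mult mult_ac)
  show "0 \<le> 4 * real r * \<alpha> * \<sigma>2 / \<sigma>1"
    using assms sigma1_pos singular_value_nonneg[of G 2] by simp
  show "0 \<le> 2 / \<gamma> * (4.7 * L * sqrt m) * sqrt (real (2 * r)) / \<sigma>1"
    unfolding b using c_nonneg by simp
  show "sqrt 2 * (4 * real r * \<alpha> * \<sigma>2 / \<sigma>1) \<le> max ?A ?B"
    by (simp add: mult_ac)
  \<comment> \<open>The constant 32.16 comes from
    \<open>(2 + sqrt 2) * 9.4 \<le> 3.42 * 9.4 = 32.148\<close>, with
    \<open>9.4 = 2 * 4.7\<close>.\<close>
  have "sqrt 2 \<le> (1.42 :: real)"
    by (rule real_le_lsqrt) (simp_all add: power2_eq_square)
  then have "(2 + sqrt 2) * (9.4 * c) \<le> 3.42 * (9.4 * c)"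
    using c_nonneg by (intro mult_right_mono) simp_all
  also have "\<dots> \<le> 32.16 * c"
    using c_nonneg by simp
  also have "\<dots> = 32.16 * (sqrt 2 * L / \<gamma>) * (sqrt m * sqrt r / \<sigma>1)"
    by (simp add: c_def)
  also have "\<dots> \<le> 32.16 * (sqrt 2 * L / \<gamma>) * (m * sqrt (real r ^ 3 * n) / \<sigma>1\<^sup>2)"
    using assms by (intro mult_left_mono sampling_term_le) simp
  also have "\<dots> = ?B"
    by (simp add: mult_ac)
  finally show "(2 + sqrt 2) * (2 / \<gamma> * (4.7 * L * sqrt m) * sqrt (real (2 * r)) / \<sigma>1) \<le> max ?A ?B"
    unfolding b by (rule max.coboundedI2)
qed

text \<open>Since \<open>n \<le> m\<close>, the top singular value is at least \<open>d\<close>. The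
  edge count is \<open>m * d\<close>, so \<open>sqrt d / d = sqrt m / sqrt (card \<Omega>)\<close>
  and \<open>m / d\<^sup>2 = m ^ 3 / (card \<Omega>)\<^sup>2\<close>.\<close>

lemma max_bound_le_card:
  fixes r :: nat and c1 c2 C :: real
  assumes "0 \<le> c1" "0 \<le> c2" and A2: "assumption_A2 G d C"
  shows "max (c1 * r * \<sigma>2 / \<sigma>1) (c2 * m * sqrt (real r ^ 3 * n) / \<sigma>1\<^sup>2)
    \<le> max (c1 * C * r * sqrt m / sqrt (card \<Omega>)) (c2 * real m ^ 3 * sqrt (real r ^ 3 * n) / (real (card \<Omega>))\<^sup>2)"
proof (rule max.mono)
  have dmn: "0 < real d" "0 < real m" "0 < real n" "real n \<le> real m"
    using n d by auto
  have s1_ge: "d \<le> \<sigma>1"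
  proof -
    have "real d * sqrt n \<le> d * sqrt m" using n by (intro mult_left_mono) simp_all
    then show ?thesis unfolding sigma1 using dmn by (simp add: le_divide_eq)
  qed
  have "\<sigma>2 / \<sigma>1 \<le> \<sigma>2 / d"
    using s1_ge dmn sigma1_pos singular_value_nonneg by (intro divide_left_mono) auto
  also have "\<dots> \<le> C * sqrt d / d"
    using A2 by (intro divide_right_mono) (simp_all add: assumption_A2_def)
  also have "\<dots> = C * sqrt m / sqrt (card \<Omega>)"
    using dmn by (simp add: card_edges real_sqrt_mult real_div_sqrt field_simps)
  finally have "c1 * r * (\<sigma>2 / \<sigma>1) \<le> c1 * r * (C * sqrt m / sqrt (card \<Omega>))"
    using assms by (intro mult_left_mono) simp_all
  then show "c1 * r * \<sigma>2 / \<sigma>1 \<le> c1 * C * r * sqrt m / sqrt (card \<Omega>)"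
    by (simp add: mult_ac)
  have "m / \<sigma>1\<^sup>2 \<le> m / (real d)\<^sup>2"
    using s1_ge dmn sigma1_pos by (intro divide_left_mono power_mono) auto
  also have "\<dots> = real m ^ 3 / (real (card \<Omega>))\<^sup>2"
    using dmn by (simp add: card_edges power2_eq_square power3_eq_cube)
  finally have "c2 * sqrt (real r ^ 3 * n) * (m / \<sigma>1\<^sup>2) \<le> c2 * sqrt (real r ^ 3 * n) * (real m ^ 3 / (real (card \<Omega>))\<^sup>2)"
    using assms by (intro mult_left_mono) simp_all
  then show "c2 * m * sqrt (real r ^ 3 * n) / \<sigma>1\<^sup>2 \<le> c2 * real m ^ 3 * sqrt (real r ^ 3 * n) / (real (card \<Omega>))\<^sup>2"
    by (simp add: mult_ac)
qed

end

section \<open>Combination of the deterministic and the probabilistic estimates\<close>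

lemma constraint_set_diff_rank_one_sum:
  assumes "M \<in> constraint_set m n \<alpha> r" "M' \<in> constraint_set m n \<alpha> r"
  shows "\<exists>a b. \<forall>i<m. \<forall>j<n. M $$ (i, j) - M' $$ (i, j) = (\<Sum>l<2 * r. a l i * b l j)"
proof -
  have M: "M \<in> carrier_mat m n" "vec_space.rank m M \<le> r"
    and M': "M' \<in> carrier_mat m n" "vec_space.rank m M' \<le> r"
    using assms by (auto simp: constraint_set_def)
  obtain a b where ab: "\<forall>i<m. \<forall>j<n. M $$ (i, j) = (\<Sum>l<r. a l i * b l j)"
    using rank_le_imp_sum_of_rank_one[OF M] by (elim exE)
  obtain a' b' where ab': "\<forall>i<m. \<forall>j<n. M' $$ (i, j) = (\<Sum>l<r. a' l i * b' l j)"
    using rank_le_imp_sum_of_rank_one[OF M'] by (elim exE)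
  obtain c e where ce: "\<forall>i j. (\<Sum>l<r. a l i * b l j) - (\<Sum>l<r. a' l i * b' l j) = (\<Sum>l<2 * r. c l i * e l j)"
    using rank_one_sum_diff[where p = r and a = a and b = b and a' = a' and b' = b'] by (elim exE)
  have "\<forall>i<m. \<forall>j<n. M $$ (i, j) - M' $$ (i, j) = (\<Sum>l<2 * r. c l i * e l j)"
    using ab ab' ce by simp
  then show ?thesis by (intro exI)
qed

locale one_bit_completion = link_function f \<alpha> \<gamma> L + regular_graph m n d \<Omega> G
  for f \<alpha> \<gamma> L m n d \<Omega> G +
  fixes r :: nat and Mstar :: "real mat"
  assumes Mstar: "Mstar \<in> constraint_set m n \<alpha> r"
begin

lemma Mstar_entry: "ij \<in> \<Omega> \<Longrightarrow> \<bar>Mstar $$ ij\<bar> \<le> \<alpha>"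
  using Om constraint_set_entry_le[OF Mstar] by (cases ij) auto

lemma minimizer_error_le:
  assumes Y: "\<And>ij. ij \<in> \<Omega> \<Longrightarrow> Y ij = 1 \<or> Y ij = - 1"
    and Z: "bilinear_bound {..<m} {..<n} (\<lambda>i j. of_bool ((i, j) \<in> \<Omega>) * score Mstar (i, j) (Y (i, j))) (4.7 * L * sqrt m)"
    and Mhat: "is_arg_min (neg_log_likelihood f \<Omega> Y) (\<lambda>M. M \<in> constraint_set m n \<alpha> r) Mhat"
  shows "1 / sqrt (real m * real n) * frobenius_norm (Mhat - Mstar) \<le>
    max (4 * sqrt 2 * \<alpha> * r * \<sigma>2 / \<sigma>1) (32.16 * sqrt 2 * L / \<gamma> * m * sqrt (real r ^ 3 * n) / \<sigma>1\<^sup>2)"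
proof -
  define D where "D i j = Mhat $$ (i, j) - Mstar $$ (i, j)" for i j
  have Mhat_mem: "Mhat \<in> constraint_set m n \<alpha> r"
    and le: "neg_log_likelihood f \<Omega> Y Mhat \<le> neg_log_likelihood f \<Omega> Y Mstar"
    using Mhat Mstar by (auto simp: is_arg_min_def not_less)
  have Mhat_entry: "\<bar>Mhat $$ ij\<bar> \<le> \<alpha>" if "ij \<in> \<Omega>" for ij
    using that Om constraint_set_entry_le[OF Mhat_mem] by (cases ij) auto
  obtain a b where ab: "\<forall>i<m. \<forall>j<n. Mhat $$ (i, j) - Mstar $$ (i, j) = (\<Sum>l<2 * r. a l i * b l j)"
    using constraint_set_diff_rank_one_sum[OF Mhat_mem Mstar] by (elim exE)
  \<comment> \<open>\<open>Mstar\<close> is feasible, so the likelihood terms at \<open>Mhat\<close>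
    and \<open>Mstar\<close> cancel in the strong convexity inequality with the right sign.\<close>
  have taylor: "(\<Sum>ij\<in>\<Omega>. score Mstar ij (Y ij) * (Mhat $$ ij - Mstar $$ ij))
      + \<gamma> / 2 * (\<Sum>ij\<in>\<Omega>. (Mhat $$ ij - Mstar $$ ij)\<^sup>2) \<le> 0"
    using neg_log_likelihood_lower_bound[where Y = Y and M = Mstar and M' = Mhat,
        OF finite_edges Y Mstar_entry Mhat_entry] le by simp
  have score_sum: "(\<Sum>ij\<in>\<Omega>. score Mstar ij (Y ij) * (Mhat $$ ij - Mstar $$ ij)) =
      (\<Sum>i<m. \<Sum>j<n. of_bool ((i, j) \<in> \<Omega>) * score Mstar (i, j) (Y (i, j)) * D i j)"
    unfolding sum_edges D_def by (simp add: mult.assoc)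
  have square_sum: "(\<Sum>ij\<in>\<Omega>. (Mhat $$ ij - Mstar $$ ij)\<^sup>2) = (\<Sum>i<m. \<Sum>j<n. G $$ (i, j) * (D i j)\<^sup>2)"
    unfolding sum_edges D_def by (intro sum.cong refl) (simp add: G_index)
  have curv: "\<gamma> / 2 * (\<Sum>i<m. \<Sum>j<n. G $$ (i, j) * (D i j)\<^sup>2)
      \<le> - (\<Sum>i<m. \<Sum>j<n. of_bool ((i, j) \<in> \<Omega>) * score Mstar (i, j) (Y (i, j)) * D i j)"
    using taylor unfolding score_sum square_sum by linarith
  have D_low: "D i j = (\<Sum>l<2 * r. a l i * b l j)" if "i < m" "j < n" for i j
    using ab that by (simp add: D_def)
  have D_bound: "\<bar>D i j\<bar> \<le> 2 * \<alpha>" if "i < m" "j < n" for i j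
    using constraint_set_entry_le[OF Mhat_mem that] constraint_set_entry_le[OF Mstar that]
    unfolding D_def by linarith
  have "sqrt (\<Sum>i<m. \<Sum>j<n. (D i j)\<^sup>2) / sqrt (m * n)
    \<le> 4 * real r * \<alpha> * \<sigma>2 / \<sigma>1 + 2 / \<gamma> * (4.7 * L * sqrt m) * sqrt (real (2 * r)) / \<sigma>1"
    using alpha_pos L_pos
    by (intro error_le[OF D_low D_bound _ gamma_pos _ Z curv]) simp_all
  then have "sqrt (\<Sum>i<m. \<Sum>j<n. (D i j)\<^sup>2) / sqrt (m * n) \<le>
      max (4 * sqrt 2 * \<alpha> * r * \<sigma>2 / \<sigma>1) (32.16 * sqrt 2 * L / \<gamma> * m * sqrt (real r ^ 3 * n) / \<sigma>1\<^sup>2)"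
    using alpha_pos by (intro max_bound gamma_pos L_pos) simp_all
  moreover have "frobenius_norm (Mhat - Mstar) = sqrt (\<Sum>i<m. \<Sum>j<n. (D i j)\<^sup>2)"
  proof -
    have "dim_row Mstar = m" "dim_col Mstar = n"
      using Mstar by (auto simp: constraint_set_def)
    then show ?thesis by (simp add: frobenius_norm_def D_def)
  qed
  ultimately show ?thesis by simp
qed

text \<open>One event serves all minimizers at once, since the bound on the score matrix does not
  mention \<open>Mhat\<close>.\<close>

lemma prob_minimizer_error_le:
  "measure_pmf.prob (one_bit_observations f \<Omega> Mstar)
    {Y. \<forall>Mhat. is_arg_min (neg_log_likelihood f \<Omega> Y) (\<lambda>M. M \<in> constraint_set m n \<alpha> r) Mhat \<longrightarrow>
      1 / sqrt (real m * real n) * frobenius_norm (Mhat - Mstar) \<le>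
      max (4 * sqrt 2 * \<alpha> * r * \<sigma>2 / \<sigma>1) (32.16 * sqrt 2 * L / \<gamma> * m * sqrt (real r ^ 3 * n) / \<sigma>1\<^sup>2)}
    \<ge> 1 - exp (- real m)"
    (is "measure_pmf.prob ?M ?good \<ge> _")
proof -
  let ?E = "{Y. bilinear_bound {..<m} {..<n}
      (\<lambda>i j. of_bool ((i, j) \<in> \<Omega>) * score Mstar (i, j) (Y (i, j))) (4.7 * L * sqrt m)}"
  have "1 - exp (- real m) \<le> measure_pmf.prob ?M ?E"
    using n by (intro prob_score_bilinear_bound Om Mstar_entry) simp_all
  \<comment> \<open>The observations are known to be 1 or -1 on \<Omega> only for \<open>Y\<close>
    in the support.\<close>
  also have "\<dots> = measure_pmf.prob ?M (?E \<inter> set_pmf ?M)"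
    by (rule measure_Int_set_pmf[symmetric])
  also have "\<dots> \<le> measure_pmf.prob ?M ?good"
  proof (rule measure_pmf.finite_measure_mono)
    show "?E \<inter> set_pmf ?M \<subseteq> ?good"
    proof
      fix Y assume "Y \<in> ?E \<inter> set_pmf ?M"
      then have E: "bilinear_bound {..<m} {..<n}
          (\<lambda>i j. of_bool ((i, j) \<in> \<Omega>) * score Mstar (i, j) (Y (i, j))) (4.7 * L * sqrt m)"
        and Y: "Y \<in> set_pmf ?M"
        by simp_all
      show "Y \<in> ?good"
        by (intro CollectI allI impI)
          (rule minimizer_error_le[OF one_bit_observations_support[OF finite_edges Y] E])
    qed
  qed simp
  finally show ?thesis .
qed

end

theorem mainTheorem1:
  shows "\<exists>C1 C2 :: real. C1 > 0 \<and> C2 > 0 \<and>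
    (\<forall>(m::nat) (n::nat) (r::nat) (d::nat) (\<alpha>::real) (f::real \<Rightarrow> real) (\<gamma>::real) (L::real) (C::real)
      (\<Omega>::(nat \<times> nat) set) (Mstar::real mat) (G::real mat) (C1\<alpha>::real) (C2\<alpha>::real).
      1 \<le> n \<and> n \<le> m \<and> 1 \<le> r \<and> 1 \<le> d \<and> 0 < \<alpha> \<and> 0 < C \<and>
      (\<forall>x. 0 \<le> f x \<and> f x \<le> 1) \<and>
      (\<forall>x. f differentiable (at x)) \<and> (\<forall>x. deriv f differentiable (at x)) \<and>
      log_concave_fun f \<and>
      (\<forall>x. \<bar>x\<bar> \<le> \<alpha> \<longrightarrow> 0 < f x \<and> f x < 1) \<and>
      gamma_bound f \<alpha> \<gamma> \<and> L_bound f \<alpha> L \<and> 0 < \<gamma> \<and>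
      Mstar \<in> constraint_set m n \<alpha> r \<and>
      \<Omega> \<subseteq> {..<m} \<times> {..<n} \<and> G = biadjacency m n \<Omega> \<and>
      row_regular m n \<Omega> d \<and> assumption_A1 G \<and> assumption_A2 G d C \<and>
      C1\<alpha> = 4 * sqrt 2 * \<alpha> \<and> C2\<alpha> = 32.16 * sqrt 2 * L / \<gamma>
      \<longrightarrow>
      measure_pmf.prob (one_bit_observations f \<Omega> Mstar)
        {Y. \<forall>Mhat. is_arg_min (neg_log_likelihood f \<Omega> Y) (\<lambda>M. M \<in> constraint_set m n \<alpha> r) Mhat
              \<longrightarrow> 1 / sqrt (real m * real n) * frobenius_norm (Mhat - Mstar)
                  \<le> max (C1\<alpha> * real r * singular_value G 2 / singular_value G 1)
                        (C2\<alpha> * real m * sqrt (real r ^ 3 * real n) / (singular_value G 1)\<^sup>2)}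
        \<ge> 1 - C1 * exp (- C2 * real m)
      \<and>
      max (C1\<alpha> * real r * singular_value G 2 / singular_value G 1)
          (C2\<alpha> * real m * sqrt (real r ^ 3 * real n) / (singular_value G 1)\<^sup>2)
        \<le> max (C1\<alpha> * C * real r * sqrt (real m) / sqrt (real (card \<Omega>)))
              (C2\<alpha> * real m ^ 3 * sqrt (real r ^ 3 * real n) / (real (card \<Omega>))\<^sup>2))"
\<comment> \<open>Both universal constants are 1, matching the failure probability
  \<open>exp (- m)\<close>.\<close>
proof (intro exI[of _ "1 :: real"] conjI allI impI, goal_cases)
  case (3 m n r d \<alpha> f \<gamma> L C \<Omega> Mstar G C1\<alpha> C2\<alpha>)
  then interpret one_bit_completion f \<alpha> \<gamma> L m n d \<Omega> G r Mstar
    by unfold_locales auto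
  show ?case
    using prob_minimizer_error_le 3 by simp
next
  case (4 m n r d \<alpha> f \<gamma> L C \<Omega> Mstar G C1\<alpha> C2\<alpha>)
  then interpret one_bit_completion f \<alpha> \<gamma> L m n d \<Omega> G r Mstar
    by unfold_locales auto
  have "0 \<le> C1\<alpha>" "0 \<le> C2\<alpha>"
    using 4 L_pos by simp_all
  moreover have "assumption_A2 G d C"
    using 4 by blast
  ultimately show ?case
    by (rule max_bound_le_card)
qed simp_all

end
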